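(* Let $P$ be an ergodic transition matrix over a finite space $\mathcal{X}$ with mixing time $t_{\mathsf{mix}}$, $\mu$ a probability distribution on $\mathcal{X}$, $\delta\in(0,1)$, $\lambda\in(0,\infty)^{\mathcal{X}}$ a smoothing vector, $m\in\mathbb{N}$, and $X^m=X_1,\dots,X_m\sim(\mu,P)$. With probability at least $1-\delta$, it holds that $t_{\mathsf{mix}}\in\widehat{T}_{\lambda,\delta}(X^m)$, with $$\widehat{T}_{\lambda,\delta}(X^m)=\left(\frac{\underline{c}}{1-\lfloor\widehat{\kappa}_\star(X^m)-\widehat{K}_{\lambda,\delta/2}(X^m)\rfloor_+},\ \frac{\overline{c}}{\lfloor1-\widehat{\kappa}_\star(X^m)-\widehat{K}_{\lambda,\delta/2}(X^m)\rfloor_+}\right),$$ where $\underline c,\overline c$ are universal constants, and $\widehat{\kappa}_\star$ and $\widehat{K}_{\lambda,\delta/2}$ are the fully data-dependent quantities defined in the context.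
   Context: $\mathbb{N}=\{1,2,\dots\}$, $[n]=\{1,\dots,n\}$, $\log$ is the natural logarithm, $\lfloor u\rfloor_+=\max\{u,0\}$ and $\overline c/0=+\infty$. A row-stochastic matrix $P$ over a finite set $\mathcal{X}$ is ergodic if it is primitive; $\pi$ is its stationary distribution. $X^m\sim(\mu,P)$ means a trajectory of length $m$ of the Markov chain with initial distribution $\mu$ and transition matrix $P$. $\|\mu-\nu\|_{\mathsf{TV}}=\frac12\sum_x|\mu(x)-\nu(x)|$; $t_{\mathsf{mix}}=\min\{t\in\mathbb{N}:\sup_{\mu}\|\mu P^t-\pi\|_{\mathsf{TV}}<1/4\}$. For a stochastic matrix $Q$, $\kappa(Q)=\max_{\mu,\nu}\|\mu Q-\nu Q\|_{\mathsf{TV}}$ over pairs of probability distributions; $\kappa_s=\kappa(P^s)$ and $\kappa_\star=1-\max_{s\in\mathbb{N}}\{(1-\kappa_s)/s\}$. The constants $\underline c\ge1/2$ and $\overline c\le\log(4e)$ are universal constants (known to exist) such that $\frac{\underline c}{1-\kappa_\star}\le t_{\mathsf{mix}}\le\frac{\overline c}{1-\kappa_\star}$ for every ergodic transition matrix over a finite space. For a sequence $Y^n=Y_1,\dots,Y_n$ in $\mathcal{X}$, put $N_x=\sum_{t=1}^{n-1}\mathbf{1}\{Y_t=x\}$, $N_{xx'}=\sum_{t=1}^{n-1}\mathbf{1}\{Y_t=x,Y_{t+1}=x'\}$, let $\widehat{P}_\lambda(Y^n)$ be the matrix with entries $\frac{N_{xx'}+\lambda(x)}{N_x+\lambda(x)|\mathcal{X}|}$,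 and for $\delta\in(0,1)$ $$\widehat{W}_{\lambda,\delta}(Y^n)=2\max_{x\in\mathcal{X}}\frac{\sum_{x'}\sqrt{N_{xx'}}+(3/\sqrt2)\sqrt{N_x}\sqrt{\log(2n|\mathcal{X}|/\delta)}+\lambda(x)|\mathcal{X}|}{N_x+\lambda(x)|\mathcal{X}|}.$$ For $s\in\mathbb{N}$, $X^m_{[s]}=X_1,X_{1+s},\dots,X_{1+\lfloor(m-1)/s\rfloor s}$ is the $s$-skipped trajectory (of length $1+\lfloor(m-1)/s\rfloor$; it is just $X_1$ if $s\ge m$), $\widehat{W}^{(s)}_{\lambda,\delta}(X^m)=\widehat{W}_{\lambda,\delta}(X^m_{[s]})$, and $\widehat{\kappa}_s(X^m)=\kappa(\widehat{P}_\lambda(X^m_{[s]}))$. Fix a non-decreasing function $\phi:\mathbb{N}\to\mathbb{N}$ with $\lim_{m\to\infty}\phi(m)=+\infty$. For a confidence parameter $\delta'\in(0,1)$ put $$\widehat{S}=\left\lceil\frac{1}{\max_{s\in[\phi(m)]}\{\frac1s\widehat{W}^{(s)}_{\lambda,\delta'}(X^m)\}}\right\rceil,\quad \widehat{\kappa}_\star=1-\max_{s\in[\widehat{S}]}\left\{\frac{1-\widehat{\kappa}_s(X^m)}{s}\right\},\quad \widehat{K}_{\lambda,\delta'}(X^m)=\frac1{\widehat{S}}+\max_{s\in[\widehat{S}]}\left\{\frac1s\widehat{W}^{(s)}_{\lambda,\delta'/(\lceil\sqrt m\rceil\widehat{S})}(X^m)\right\}.$$ In the claim, $\widehat S$, $\widehat\kappa_\star$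 and $\widehat K$ are all computed with $\delta'=\delta/2$. *)

theory Defs
  imports "HOL-Probability.Probability"
begin

text \<open>
  The state space is an explicit finite carrier set \<open>S\<close>; matrices over \<open>S\<close> are functions of type
  \<open>'a \<Rightarrow> 'a \<Rightarrow> real\<close> of which only the entries on \<open>S \<times> S\<close> are used.
  A type-indexed version would not do, because the universal constants quantify over all finite
  state spaces at once.
\<close>

subsection \<open>Stochastic matrices, contraction coefficients and mixing time\<close>

definition row_stochastic :: "'a set \<Rightarrow> ('a \<Rightarrow> 'a \<Rightarrow> real) \<Rightarrow> bool" where
  "row_stochastic S P \<longleftrightarrow> (\<forall>x\<in>S. (\<forall>y\<in>S. 0 \<le> P x y) \<and> (\<Sum>y\<in>S. P x y) = 1)"

fun mat_pow :: "'a set \<Rightarrow> ('a \<Rightarrow> 'a \<Rightarrow> real) \<Rightarrow> nat \<Rightarrow> 'a \<Rightarrow> 'a \<Rightarrow> real" where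
  "mat_pow S P 0 = (\<lambda>x y. if x = y then 1 else 0)"
| "mat_pow S P (Suc k) = (\<lambda>x y. \<Sum>z\<in>S. mat_pow S P k x z * P z y)"

definition primitive :: "'a set \<Rightarrow> ('a \<Rightarrow> 'a \<Rightarrow> real) \<Rightarrow> bool" where
  "primitive S P \<longleftrightarrow> (\<exists>k\<ge>1. \<forall>x\<in>S. \<forall>y\<in>S. 0 < mat_pow S P k x y)"

definition ergodic :: "'a set \<Rightarrow> ('a \<Rightarrow> 'a \<Rightarrow> real) \<Rightarrow> bool" where
  "ergodic S P \<longleftrightarrow> row_stochastic S P \<and> primitive S P"

definition distributions :: "'a set \<Rightarrow> 'a pmf set" where
  "distributions S = {\<mu>. set_pmf \<mu> \<subseteq> S}"

definition vec_mat :: "'a set \<Rightarrow> 'a pmf \<Rightarrow> ('a \<Rightarrow> 'a \<Rightarrow> real) \<Rightarrow> 'a \<Rightarrow> real" where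
  "vec_mat S \<mu> Q = (\<lambda>y. \<Sum>x\<in>S. pmf \<mu> x * Q x y)"

definition tv_dist :: "'a set \<Rightarrow> ('a \<Rightarrow> real) \<Rightarrow> ('a \<Rightarrow> real) \<Rightarrow> real" where
  "tv_dist S f g = (1/2) * (\<Sum>x\<in>S. \<bar>f x - g x\<bar>)"

definition stationary_dist :: "'a set \<Rightarrow> ('a \<Rightarrow> 'a \<Rightarrow> real) \<Rightarrow> 'a pmf" where
  "stationary_dist S P =
     (THE \<pi>. \<pi> \<in> distributions S \<and> (\<forall>y\<in>S. vec_mat S \<pi> P y = pmf \<pi> y))"

definition t_mix :: "'a set \<Rightarrow> ('a \<Rightarrow> 'a \<Rightarrow> real) \<Rightarrow> nat" where
  "t_mix S P =
     (LEAST t. 1 \<le> t \<and>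
        (SUP \<mu>\<in>distributions S.
           tv_dist S (vec_mat S \<mu> (mat_pow S P t)) (pmf (stationary_dist S P))) < 1/4)"

definition kappa :: "'a set \<Rightarrow> ('a \<Rightarrow> 'a \<Rightarrow> real) \<Rightarrow> real" where
  "kappa S Q = (SUP (\<mu>, \<nu>)\<in>distributions S \<times> distributions S.
                  tv_dist S (vec_mat S \<mu> Q) (vec_mat S \<nu> Q))"

text \<open>The maximum over all \<open>s \<ge> 1\<close> is written as a supremum because the index set is infinite; the
  terms lie in \<open>[0, 1/s]\<close>, so the supremum is finite and attained.\<close>

definition kappa_star :: "'a set \<Rightarrow> ('a \<Rightarrow> 'a \<Rightarrow> real) \<Rightarrow> real" where
  "kappa_star S P = 1 - (SUP s\<in>{1..}. (1 - kappa S (mat_pow S P s)) / real s)"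

text \<open>Every finite space is, up to relabelling, a finite nonempty set of natural numbers, so
  quantifying over such sets covers all finite state spaces.\<close>

definition universal_constants :: "real \<Rightarrow> real \<Rightarrow> bool" where
  "universal_constants c_lo c_hi \<longleftrightarrow>
     1/2 \<le> c_lo \<and> c_hi \<le> ln (4 * exp 1) \<and>
     (\<forall>(S :: nat set) P. finite S \<longrightarrow> S \<noteq> {} \<longrightarrow> ergodic S P \<longrightarrow>
        c_lo / (1 - kappa_star S P) \<le> real (t_mix S P) \<and>
        real (t_mix S P) \<le> c_hi / (1 - kappa_star S P))"

subsection \<open>Trajectories\<close>

text \<open>\<open>X 1, \<dots>, X m\<close> is a trajectory of the chain \<open>(\<mu>, P)\<close>, specified by its joint law.\<close>

definition markov_trajectory ::
  "'w measure \<Rightarrow> 'a set \<Rightarrow> 'a pmf \<Rightarrow> ('a \<Rightarrow> 'a \<Rightarrow> real) \<Rightarrow> nat \<Rightarrow> (nat \<Rightarrow> 'w \<Rightarrow> 'a) \<Rightarrow> bool" where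
  "markov_trajectory M S \<mu> P m X \<longleftrightarrow>
     (\<forall>t\<in>{1..m}. X t \<in> measurable M (count_space S)) \<and>
     (\<forall>y. (\<forall>t\<in>{1..m}. y t \<in> S) \<longrightarrow>
        measure M {\<omega>\<in>space M. \<forall>t\<in>{1..m}. X t \<omega> = y t} =
          pmf \<mu> (y 1) * (\<Prod>t\<in>{1..<m}. P (y t) (y (t + 1))))"

subsection \<open>Estimators\<close>

text \<open>A sequence \<open>Y\<^sub>1, \<dots>, Y\<^sub>n\<close> is represented by its length \<open>n\<close> together with a function
  \<open>Y :: nat \<Rightarrow> 'a\<close> of which only the values at \<open>1, \<dots>, n\<close> are used.\<close>

definition visits :: "nat \<Rightarrow> (nat \<Rightarrow> 'a) \<Rightarrow> 'a \<Rightarrow> nat" where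
  "visits n Y x = card {t. 1 \<le> t \<and> t < n \<and> Y t = x}"

definition transitions :: "nat \<Rightarrow> (nat \<Rightarrow> 'a) \<Rightarrow> 'a \<Rightarrow> 'a \<Rightarrow> nat" where
  "transitions n Y x x' = card {t. 1 \<le> t \<and> t < n \<and> Y t = x \<and> Y (t + 1) = x'}"

definition P_hat :: "'a set \<Rightarrow> ('a \<Rightarrow> real) \<Rightarrow> nat \<Rightarrow> (nat \<Rightarrow> 'a) \<Rightarrow> 'a \<Rightarrow> 'a \<Rightarrow> real" where
  "P_hat S lam n Y x x' =
     (real (transitions n Y x x') + lam x) / (real (visits n Y x) + lam x * real (card S))"

definition W_hat :: "'a set \<Rightarrow> ('a \<Rightarrow> real) \<Rightarrow> real \<Rightarrow> nat \<Rightarrow> (nat \<Rightarrow> 'a) \<Rightarrow> real" where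
  "W_hat S lam d n Y =
     2 * Max ((\<lambda>x.
        ((\<Sum>x'\<in>S. sqrt (real (transitions n Y x x')))
          + (3 / sqrt 2) * sqrt (real (visits n Y x)) * sqrt (ln (2 * real n * real (card S) / d))
          + lam x * real (card S))
        / (real (visits n Y x) + lam x * real (card S))) ` S)"

definition skip_length :: "nat \<Rightarrow> nat \<Rightarrow> nat" where
  "skip_length s m = 1 + (m - 1) div s"

definition skipped :: "nat \<Rightarrow> (nat \<Rightarrow> 'a) \<Rightarrow> nat \<Rightarrow> 'a" where
  "skipped s Y i = Y (1 + (i - 1) * s)"

definition W_hat_skip ::
  "'a set \<Rightarrow> ('a \<Rightarrow> real) \<Rightarrow> real \<Rightarrow> nat \<Rightarrow> nat \<Rightarrow> (nat \<Rightarrow> 'a) \<Rightarrow> real" where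
  "W_hat_skip S lam d s m Y = W_hat S lam d (skip_length s m) (skipped s Y)"

definition kappa_hat :: "'a set \<Rightarrow> ('a \<Rightarrow> real) \<Rightarrow> nat \<Rightarrow> nat \<Rightarrow> (nat \<Rightarrow> 'a) \<Rightarrow> real" where
  "kappa_hat S lam s m Y = kappa S (P_hat S lam (skip_length s m) (skipped s Y))"

definition S_hat ::
  "'a set \<Rightarrow> (nat \<Rightarrow> nat) \<Rightarrow> ('a \<Rightarrow> real) \<Rightarrow> real \<Rightarrow> nat \<Rightarrow> (nat \<Rightarrow> 'a) \<Rightarrow> nat" where
  "S_hat S \<phi> lam d m Y =
     nat \<lceil>1 / Max ((\<lambda>s. (1 / real s) * W_hat_skip S lam d s m Y) ` {1..\<phi> m})\<rceil>"

definition kappa_star_hat ::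
  "'a set \<Rightarrow> (nat \<Rightarrow> nat) \<Rightarrow> ('a \<Rightarrow> real) \<Rightarrow> real \<Rightarrow> nat \<Rightarrow> (nat \<Rightarrow> 'a) \<Rightarrow> real" where
  "kappa_star_hat S \<phi> lam d m Y =
     1 - Max ((\<lambda>s. (1 - kappa_hat S lam s m Y) / real s) ` {1..S_hat S \<phi> lam d m Y})"

definition K_hat ::
  "'a set \<Rightarrow> (nat \<Rightarrow> nat) \<Rightarrow> ('a \<Rightarrow> real) \<Rightarrow> real \<Rightarrow> nat \<Rightarrow> (nat \<Rightarrow> 'a) \<Rightarrow> real" where
  "K_hat S \<phi> lam d m Y =
     1 / real (S_hat S \<phi> lam d m Y)
     + Max ((\<lambda>s. (1 / real s) *
          W_hat_skip S lam (d / (of_int \<lceil>sqrt (real m)\<rceil> * real (S_hat S \<phi> lam d m Y))) s m Y)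
        ` {1..S_hat S \<phi> lam d m Y})"

definition T_hat ::
  "real \<Rightarrow> real \<Rightarrow> 'a set \<Rightarrow> (nat \<Rightarrow> nat) \<Rightarrow> ('a \<Rightarrow> real) \<Rightarrow> real \<Rightarrow> nat \<Rightarrow> (nat \<Rightarrow> 'a) \<Rightarrow> ereal set" where
  "T_hat c_lo c_hi S \<phi> lam \<delta> m Y =
     (let k = kappa_star_hat S \<phi> lam (\<delta>/2) m Y;
          K = K_hat S \<phi> lam (\<delta>/2) m Y;
          a = 1 - max (k - K) 0;
          b = max (1 - k - K) 0
      in {ereal (c_lo / a) <..< (if b = 0 then \<infinity> else ereal (c_hi / b))})"

end

theory Submission
  imports Defs
begin

text \<open>
  The successors of the first \<open>k\<close> visits of the \<open>s\<close>-skipped chain to a state \<open>x\<close> are independent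
  draws from the row \<open>x\<close> of \<open>P\<^sup>s\<close>. For such draws the unnormalized total variation error minus
  \<open>\<Sum>\<^sub>y \<surd>N\<^sub>x\<^sub>y\<close> changes by at most 2 with each draw and has nonpositive mean, so McDiarmid's inequality
  and a union bound over \<open>x\<close> and \<open>k\<close> bound each row of the estimated matrix, hence the contraction
  coefficient of \<open>P\<^sup>s\<close>, with an empirical width. The random cutoff never exceeds
  \<open>\<lceil>\<surd>m\<rceil>\<close>, so a union bound over its possible values \<open>\<sigma>\<close> and over \<open>s \<le> \<sigma>\<close> costs the factor
  \<open>\<lceil>\<surd>m\<rceil> \<sigma>\<close> in the confidence. The terms with \<open>s > \<sigma>\<close> of \<open>\<kappa>\<^sub>\<star>\<close> contribute less than \<open>1/\<sigma>\<close>,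
  and the universal constants turn the bound on \<open>\<kappa>\<^sub>\<star>\<close> into one on the mixing time.
\<close>

subsection \<open>Expectations over paths\<close>

text \<open>All probability is reduced to finite sums over lists: \<open>path_exp\<close> recurses
  on the number of steps, so the Markov property, the skipping of states and the independence of
  successors become inductions, and the measure \<open>M\<close> enters only to turn an event on the
  list of states into such a sum. The number of visits to a state is random, which rules out a
  direct concentration bound; fixing it to a value k and discarding the paths with another count
  leaves k genuinely independent draws, and the pairs of state and count are what the logarithm of
  2n|S|/d pays for. The cutoff \<open>S_hat\<close> is itself built from widths; its range is
  deterministic because no width over n samples falls below 2/sqrt n. Two features of the statement
  cost extra work. The interval is open at both ends, so every comparison with \<open>t_mix\<close>
  has to be strict. The universal constants are given for sets of natural numbers only, so the
  mixing time is carried along a bijection, and with it the stationary distribution, a definite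
  description that needs existence and uniqueness.\<close>

primrec path_exp ::
  "'a set \<Rightarrow> ('a \<Rightarrow> 'a \<Rightarrow> real) \<Rightarrow> nat \<Rightarrow> 'a \<Rightarrow> ('a list \<Rightarrow> real) \<Rightarrow> real" where
  "path_exp S P 0 = (\<lambda>z h. h [])"
| "path_exp S P (Suc n) = (\<lambda>z h. \<Sum>y\<in>S. P z y * path_exp S P n y (\<lambda>ys. h (y # ys)))"

lemma row_stochastic_nonneg: "row_stochastic S P \<Longrightarrow> x \<in> S \<Longrightarrow> y \<in> S \<Longrightarrow> 0 \<le> P x y"
  by (auto simp: row_stochastic_def)

lemma row_stochastic_sum: "row_stochastic S P \<Longrightarrow> x \<in> S \<Longrightarrow> (\<Sum>y\<in>S. P x y) = 1"
  by (auto simp: row_stochastic_def)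

lemma path_exp_mono:
  assumes "row_stochastic S P" "z \<in> S"
    and "\<And>ys. set ys \<subseteq> S \<Longrightarrow> length ys = n \<Longrightarrow> h ys \<le> h' ys"
  shows "path_exp S P n z h \<le> path_exp S P n z h'"
  using assms(2,3)
proof (induction n arbitrary: z h h')
  case (Suc n)
  have "path_exp S P n y (\<lambda>ys. h (y # ys)) \<le> path_exp S P n y (\<lambda>ys. h' (y # ys))" if "y \<in> S" for y
    using that by (intro Suc.IH Suc.prems(2)) simp_all
  then show ?case
    unfolding path_exp.simps
    by (intro sum_mono mult_left_mono row_stochastic_nonneg[OF assms(1) Suc.prems(1)])
qed simp

lemma path_exp_cong:
  assumes "\<And>ys. set ys \<subseteq> S \<Longrightarrow> length ys = n \<Longrightarrow> h ys = h' ys"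
  shows "path_exp S P n z h = path_exp S P n z h'"
  using assms
proof (induction n arbitrary: z h h')
  case (Suc n)
  have "path_exp S P n y (\<lambda>ys. h (y # ys)) = path_exp S P n y (\<lambda>ys. h' (y # ys))" if "y \<in> S" for y
    using that by (intro Suc.IH Suc.prems) simp_all
  then show ?case by simp
qed simp

lemma path_exp_add:
  "path_exp S P n z (\<lambda>ys. h ys + h' ys) = path_exp S P n z h + path_exp S P n z h'"
  by (induction n arbitrary: z h h') (auto simp: algebra_simps sum.distrib)

lemma path_exp_cmult: "path_exp S P n z (\<lambda>ys. c * h ys) = c * path_exp S P n z h"
  by (induction n arbitrary: z h) (auto simp: algebra_simps sum_distrib_left)

lemma path_exp_const:
  assumes "row_stochastic S P" "z \<in> S"
  shows "path_exp S P n z (\<lambda>_. c) = c"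
  using assms(2)
  by (induction n arbitrary: z)
     (auto simp: sum_distrib_right[symmetric] row_stochastic_sum[OF assms(1)])

lemma path_exp_diff:
  "path_exp S P n z (\<lambda>ys. h ys - h' ys) = path_exp S P n z h - path_exp S P n z h'"
  using path_exp_add[of S P n z h "\<lambda>ys. -1 * h' ys"] path_exp_cmult[of S P n z "-1" h'] by simp

lemma path_exp_zero: "path_exp S P n z (\<lambda>_. 0) = 0"
  using path_exp_cmult[of S P n z 0 "\<lambda>_. 0"] by simp

lemma path_exp_sum:
  assumes "finite I"
  shows "path_exp S P n z (\<lambda>ys. \<Sum>i\<in>I. h i ys) = (\<Sum>i\<in>I. path_exp S P n z (h i))"
  using assms by (induction I rule: finite_induct) (simp_all add: path_exp_add path_exp_zero)

lemma path_exp_of_bool_Bex_le: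
  assumes "row_stochastic S P" "z \<in> S" "finite I"
  shows "path_exp S P n z (\<lambda>ys. of_bool (\<exists>i\<in>I. Q i ys))
         \<le> (\<Sum>i\<in>I. path_exp S P n z (\<lambda>ys. of_bool (Q i ys)))"
proof -
  have "of_bool (\<exists>i\<in>I. Q i ys) \<le> (\<Sum>i\<in>I. of_bool (Q i ys) :: real)" for ys
  proof (cases "\<exists>i\<in>I. Q i ys")
    case True
    then obtain i where "i \<in> I" "Q i ys" by blast
    then show ?thesis
      using member_le_sum[of i I "\<lambda>i. of_bool (Q i ys) :: real"] assms(3) by auto
  next
    case False
    then show ?thesis by (auto intro!: sum_nonneg)
  qed
  then show ?thesis
    by (subst path_exp_sum[OF assms(3), symmetric]) (intro path_exp_mono assms)
qed

text \<open>A kernel that ignores the current state makes the visited states independent draws from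
  \<open>p\<close>. This is the encoding of i.i.d. samples used below; the start that
  \<open>path_exp\<close> still demands is a dummy.\<close>

lemma path_exp_const_kernel_indep:
  "path_exp S (\<lambda>_. p) n y h = path_exp S (\<lambda>_. p) n z h"
  by (cases n) auto

text \<open>The Markov property at time \<open>m\<close>: the past reaches the future only through
  its last state, which is \<open>z\<close> itself when \<open>m = 0\<close>; hence
  \<open>last (z # us)\<close>.\<close>

lemma path_exp_append:
  "path_exp S P (m + n) z h =
     path_exp S P m z (\<lambda>us. path_exp S P n (last (z # us)) (\<lambda>vs. h (us @ vs)))"
proof (induction m arbitrary: z h)
  case (Suc m)
  have "path_exp S P m y (\<lambda>us. path_exp S P n (last (y # us)) (\<lambda>vs. h (y # us @ vs)))
      = path_exp S P m y (\<lambda>us. path_exp S P n (last (z # y # us)) (\<lambda>vs. h ((y # us) @ vs)))" for y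
    by simp
  then show ?case
    by (simp add: Suc.IH)
qed auto

section \<open>Powers of the transition matrix and skipped steps\<close>

lemma mat_pow_1: "finite S \<Longrightarrow> x \<in> S \<Longrightarrow> mat_pow S P 1 x y = P x y"
  by (simp add: if_distrib[of "\<lambda>u. u * _"] cong: if_cong)

lemma mat_pow_add:
  assumes "finite S" "y \<in> S"
  shows "mat_pow S P (m + n) x y = (\<Sum>z\<in>S. mat_pow S P m x z * mat_pow S P n z y)"
  using assms(2)
proof (induction n arbitrary: y)
  case 0
  then show ?case
    using assms(1) by (simp add: if_distrib[of "\<lambda>u. _ * u"] cong: if_cong)
next
  case (Suc n)
  have "mat_pow S P (m + Suc n) x y = (\<Sum>w\<in>S. (\<Sum>z\<in>S. mat_pow S P m x z * mat_pow S P n z w) * P w y)"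
    by (simp add: Suc.IH)
  also have "\<dots> = (\<Sum>z\<in>S. \<Sum>w\<in>S. mat_pow S P m x z * (mat_pow S P n z w * P w y))"
    by (subst sum.swap) (simp add: sum_distrib_right mult.assoc)
  finally show ?case by (simp add: sum_distrib_left)
qed

lemma mat_pow_Suc_left:
  assumes "finite S" "x \<in> S" "y \<in> S"
  shows "mat_pow S P (Suc n) x y = (\<Sum>z\<in>S. P x z * mat_pow S P n z y)"
  using mat_pow_add[OF assms(1,3), of P 1 n x] mat_pow_1[OF assms(1,2), of P] by simp

lemma row_stochastic_mat_pow:
  assumes "finite S" "row_stochastic S P"
  shows "row_stochastic S (mat_pow S P n)"
proof (induction n)
  case 0
  then show ?case using assms(1) by (auto simp: row_stochastic_def)
next
  case (Suc n)
  have "(\<Sum>y\<in>S. mat_pow S P (Suc n) x y) = 1" if x: "x \<in> S" for x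
  proof -
    have "(\<Sum>y\<in>S. mat_pow S P (Suc n) x y) = (\<Sum>z\<in>S. mat_pow S P n x z * (\<Sum>y\<in>S. P z y))"
      by (simp add: sum_distrib_left) (rule sum.swap)
    also have "\<dots> = (\<Sum>z\<in>S. mat_pow S P n x z)"
      by (intro sum.cong) (auto simp: row_stochastic_sum[OF assms(2)])
    finally show ?thesis using row_stochastic_sum[OF Suc x] by simp
  qed
  moreover have "0 \<le> mat_pow S P (Suc n) x y" if "x \<in> S" "y \<in> S" for x y
    using that by (auto intro!: sum_nonneg mult_nonneg_nonneg row_stochastic_nonneg[OF Suc]
        row_stochastic_nonneg[OF assms(2)])
  ultimately show ?case unfolding row_stochastic_def by blast
qed

lemma path_exp_last:
  assumes "finite S" "z \<in> S"
  shows "path_exp S P s z (\<lambda>us. f (last (z # us))) = (\<Sum>y\<in>S. mat_pow S P s z y * f y)"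
  using assms(2)
proof (induction s arbitrary: z)
  case 0
  then show ?case
    using assms(1) by (simp add: if_distrib[of "\<lambda>u. u * _"] cong: if_cong)
next
  case (Suc s)
  have "path_exp S P (Suc s) z (\<lambda>us. f (last (z # us)))
      = (\<Sum>w\<in>S. P z w * (\<Sum>y\<in>S. mat_pow S P s w y * f y))"
    by (simp add: Suc.IH[symmetric])
  also have "\<dots> = (\<Sum>y\<in>S. (\<Sum>w\<in>S. P z w * mat_pow S P s w y) * f y)"
    by (simp add: sum_distrib_left sum_distrib_right mult.assoc) (rule sum.swap)
  also have "\<dots> = (\<Sum>y\<in>S. mat_pow S P (Suc s) z y * f y)"
    by (intro sum.cong) (simp_all add: mat_pow_Suc_left[OF assms(1) Suc.prems] del: mat_pow.simps)
  finally show ?case .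
qed

text \<open>Cutting off the first \<open>s\<close> steps exposes one transition of the skipped
  chain, and the part already read is absorbed into \<open>h\<close>, which is why \<open>h\<close>
  is generalized in the induction. The \<open>r\<close> steps after the last retained time integrate
  to 1.\<close>

lemma path_exp_skip:
  assumes "finite S" "row_stochastic S P" "1 \<le> s" "z \<in> S"
  shows "path_exp S P (q * s + r) z (\<lambda>ys. h (map (\<lambda>i. (z # ys) ! (i * s)) [0..<Suc q]))
       = path_exp S (mat_pow S P s) q z (\<lambda>zs. h (z # zs))"
  using assms(4)
proof (induction q arbitrary: z h)
  case 0
  then show ?case by (simp add: path_exp_const[OF assms(2)])
next
  case (Suc q)
  have split: "path_exp S P (q * s + r) (last (z # us))
        (\<lambda>vs. h (map (\<lambda>i. (z # us @ vs) ! (i * s)) [0..<Suc (Suc q)]))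
      = path_exp S P (q * s + r) (last (z # us))
        (\<lambda>vs. h (z # map (\<lambda>i. (last (z # us) # vs) ! (i * s)) [0..<Suc q]))"
    if "set us \<subseteq> S" "length us = s" for us
  proof -
    \<comment> \<open>Here \<open>1 \<le> s\<close> matters: the block is nonempty, so the next
      block starts in \<open>last us\<close>.\<close>
    have ne: "us \<noteq> []" using that assms(3) by auto
    have us: "us = butlast us @ [last us]" using ne by simp
    have nth: "(z # us @ vs) ! (Suc i * s) = (last us # vs) ! (i * s)" for i vs
    proof -
      have len: "length (z # butlast us) = s" using that ne assms(3) by simp
      have "z # us @ vs = (z # butlast us) @ (last us # vs)"
        using us by (metis append.assoc append_Cons append_Nil)
      then have "(z # us @ vs) ! (Suc i * s)
          = ((z # butlast us) @ (last us # vs)) ! (length (z # butlast us) + i * s)"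
        by (simp only: len mult_Suc)
      then show ?thesis by (simp only: nth_append_length_plus)
    qed
    have "map (\<lambda>i. (z # us @ vs) ! (i * s)) [0..<Suc (Suc q)]
        = z # map (\<lambda>i. (last (z # us) # vs) ! (i * s)) [0..<Suc q]" for vs
    proof -
      have "[0..<Suc (Suc q)] = 0 # map Suc [0..<Suc q]"
        by (subst upt_conv_Cons) (simp_all only: map_Suc_upt zero_less_Suc)
      then show ?thesis
        using ne by (simp only: list.map map_map o_def nth) simp
    qed
    then show ?thesis by (simp only:)
  qed
  have "path_exp S P (Suc q * s + r) z (\<lambda>ys. h (map (\<lambda>i. (z # ys) ! (i * s)) [0..<Suc (Suc q)]))
      = path_exp S P s z (\<lambda>us. path_exp S P (q * s + r) (last (z # us))
        (\<lambda>vs. h (map (\<lambda>i. (z # us @ vs) ! (i * s)) [0..<Suc (Suc q)])))"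
    by (simp only: mult_Suc add.assoc path_exp_append[of S P s "q * s + r" z])
  also have "\<dots> = path_exp S P s z (\<lambda>us. path_exp S P (q * s + r) (last (z # us))
        (\<lambda>vs. h (z # map (\<lambda>i. (last (z # us) # vs) ! (i * s)) [0..<Suc q])))"
    by (rule path_exp_cong) (rule split)
  also have "\<dots> = (\<Sum>y\<in>S. mat_pow S P s z y * path_exp S P (q * s + r) y
        (\<lambda>vs. h (z # map (\<lambda>i. (y # vs) ! (i * s)) [0..<Suc q])))"
    by (rule path_exp_last[OF assms(1) Suc.prems])
  also have "\<dots> = (\<Sum>y\<in>S. mat_pow S P s z y * path_exp S (mat_pow S P s) q y (\<lambda>zs. h (z # y # zs)))"
    by (rule sum.cong[OF refl], rule arg_cong[where f = "(*) _"],
        erule Suc.IH[where h = "\<lambda>l. h (z # l)"])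
  finally show ?case by (simp only: path_exp.simps)
qed

text \<open>The bridge from the recursion to the product form in which
  \<open>markov_trajectory\<close> gives the joint law.\<close>

lemma path_exp_eq_sum:
  "path_exp S P n z h
   = (\<Sum>ys | set ys \<subseteq> S \<and> length ys = n. (\<Prod>i<n. P ((z # ys) ! i) (ys ! i)) * h ys)"
proof (induction n arbitrary: z h)
  case 0
  have "{ys. set ys \<subseteq> S \<and> length ys = 0} = {[]}" by auto
  then show ?case by simp
next
  case (Suc n)
  let ?L = "{ys. set ys \<subseteq> S \<and> length ys = n}"
  have "(\<Sum>ys | set ys \<subseteq> S \<and> length ys = Suc n. (\<Prod>i<Suc n. P ((z # ys) ! i) (ys ! i)) * h ys)
      = (\<Sum>(ys, y)\<in>?L \<times> S. (\<Prod>i<Suc n. P ((z # y # ys) ! i) ((y # ys) ! i)) * h (y # ys))"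
    unfolding lists_length_Suc_eq
    by (subst sum.reindex) (auto simp: inj_on_def case_prod_unfold)
  also have "\<dots> = (\<Sum>y\<in>S. \<Sum>ys\<in>?L. (\<Prod>i<Suc n. P ((z # y # ys) ! i) ((y # ys) ! i)) * h (y # ys))"
    by (subst sum.cartesian_product[symmetric]) (rule sum.swap)
  also have "\<dots> = path_exp S P (Suc n) z h"
    by (simp add: Suc.IH prod.lessThan_Suc_shift sum_distrib_left mult.assoc del: prod.lessThan_Suc)
  finally show ?case by simp
qed

text \<open>Only the joint law of the first \<open>m\<close> states is known, so events are
  expressed through the list \<open>L \<omega>\<close>. It takes finitely many values, so for an
  arbitrary predicate \<open>R\<close> the event is a finite disjoint union of cylinders
  \<open>A l\<close>, each measurable and of known probability.\<close>

lemma markov_trajectory_path_exp: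
  assumes "finite S" "prob_space M" "markov_trajectory M S \<mu> P m X" "1 \<le> m"
  defines "L \<equiv> (\<lambda>\<omega>. map (\<lambda>t. X t \<omega>) [1..<Suc m])"
  shows "{\<omega>\<in>space M. R (L \<omega>)} \<in> sets M"
    and "measure M {\<omega>\<in>space M. R (L \<omega>)}
         = (\<Sum>z\<in>S. pmf \<mu> z * path_exp S P (m - 1) z (\<lambda>ys. of_bool (R (z # ys))))"
proof -
  interpret prob_space M by fact
  from assms(4) obtain n where m: "m = Suc n" by (cases m) auto
  define A where "A = (\<lambda>l. {\<omega>\<in>space M. L \<omega> = l})"
  let ?LL = "{l. set l \<subseteq> S \<and> length l = m}"
  have X: "X t \<in> measurable M (count_space S)" if "t \<in> {1..m}" for t
    using assms(3) that by (auto simp: markov_trajectory_def)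
  have XS: "X t \<omega> \<in> S" if "t \<in> {1..m}" "\<omega> \<in> space M" for t \<omega>
    using measurable_space[OF X[OF that(1)] that(2)] by simp
  have L_eq: "L \<omega> = l \<longleftrightarrow> (\<forall>t\<in>{1..m}. X t \<omega> = l ! (t - 1))" if "length l = m" for \<omega> l
  proof -
    have "L \<omega> = l \<longleftrightarrow> (\<forall>i<m. X (Suc i) \<omega> = l ! i)"
      unfolding L_def list_eq_iff_nth_eq using that by (auto simp del: upt_Suc)
    also have "\<dots> \<longleftrightarrow> (\<forall>t\<in>{1..m}. X t \<omega> = l ! (t - 1))"
    proof safe
      fix t assume *: "\<forall>i<m. X (Suc i) \<omega> = l ! i" "t \<in> {1..m}"
      then show "X t \<omega> = l ! (t - 1)" using *(1)[rule_format, of "t - 1"] by auto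
    next
      fix i assume *: "\<forall>t\<in>{1..m}. X t \<omega> = l ! (t - 1)" "i < m"
      then show "X (Suc i) \<omega> = l ! i" using *(1)[rule_format, of "Suc i"] by auto
    qed
    finally show ?thesis .
  qed
  have A_sets: "A l \<in> sets M" if "l \<in> ?LL" for l
  proof -
    have "A l = (\<Inter>t\<in>{1..m}. X t -` {l ! (t - 1)} \<inter> space M)"
      unfolding A_def using L_eq[of l] that m by auto
    moreover have "X t -` {l ! (t - 1)} \<inter> space M \<in> sets M" if t: "t \<in> {1..m}" for t
    proof (rule measurable_sets[OF X[OF t]])
      have "l ! (t - 1) \<in> set l" using \<open>l \<in> ?LL\<close> t by (intro nth_mem) auto
      then show "{l ! (t - 1)} \<in> sets (count_space S)" using \<open>l \<in> ?LL\<close> by auto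
    qed
    ultimately show ?thesis by (simp only:) (rule sets.finite_INT, use m in auto)
  qed
  have A_measure: "measure M (A l) = pmf \<mu> (l ! 0) * (\<Prod>i<n. P (l ! i) (l ! Suc i))"
    if "l \<in> ?LL" for l
  proof -
    have "\<forall>t\<in>{1..m}. l ! (t - 1) \<in> S"
    proof
      fix t assume "t \<in> {1..m}"
      then have "l ! (t - 1) \<in> set l" using that by (intro nth_mem) auto
      then show "l ! (t - 1) \<in> S" using that by auto
    qed
    then have "measure M {\<omega>\<in>space M. \<forall>t\<in>{1..m}. X t \<omega> = l ! (t - 1)}
        = pmf \<mu> (l ! (1 - 1)) * (\<Prod>t\<in>{1..<m}. P (l ! (t - 1)) (l ! (t + 1 - 1)))"
      using assms(3) unfolding markov_trajectory_def by (elim conjE) (erule allE, erule (1) mp)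
    moreover have "(\<Prod>t\<in>{1..<m}. P (l ! (t - 1)) (l ! (t + 1 - 1))) = (\<Prod>i<n. P (l ! i) (l ! Suc i))"
      unfolding m by (rule prod.reindex_bij_witness[of _ Suc "\<lambda>t. t - 1"]) auto
    ultimately show ?thesis unfolding A_def using L_eq[of l] that by simp
  qed
  have fin: "finite ?LL" by (rule finite_lists_length_eq[OF assms(1)])
  have L_mem: "L \<omega> \<in> ?LL" if "\<omega> \<in> space M" for \<omega>
    using XS that unfolding L_def by (auto simp del: upt_Suc)
  have un: "{\<omega>\<in>space M. R (L \<omega>)} = (\<Union>l\<in>{l\<in>?LL. R l}. A l)"
    unfolding A_def using L_mem by auto
  have finR: "finite {l\<in>?LL. R l}" by (rule finite_subset[OF _ fin]) auto
  show "{\<omega>\<in>space M. R (L \<omega>)} \<in> sets M"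
    unfolding un by (rule sets.finite_UN[OF finR]) (use A_sets in auto)
  have "measure M {\<omega>\<in>space M. R (L \<omega>)} = (\<Sum>l\<in>{l\<in>?LL. R l}. measure M (A l))"
    unfolding un
    by (rule finite_measure_finite_Union[OF finR]) (use A_sets in \<open>auto simp: A_def disjoint_family_on_def\<close>)
  also have "\<dots> = (\<Sum>l\<in>?LL. measure M (A l) * of_bool (R l))"
    by (rule sum.mono_neutral_cong_left[OF fin]) auto
  also have "\<dots> = (\<Sum>l\<in>?LL. pmf \<mu> (l ! 0) * (\<Prod>i<n. P (l ! i) (l ! Suc i)) * of_bool (R l))"
    by (intro sum.cong) (simp_all add: A_measure)
  also have "\<dots> = (\<Sum>(ys, z)\<in>{ys. set ys \<subseteq> S \<and> length ys = n} \<times> S.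
      pmf \<mu> z * (\<Prod>i<n. P ((z # ys) ! i) (ys ! i)) * of_bool (R (z # ys)))"
    unfolding m lists_length_Suc_eq
    by (subst sum.reindex) (auto simp: inj_on_def case_prod_unfold)
  also have "\<dots> = (\<Sum>z\<in>S. \<Sum>ys\<in>{ys. set ys \<subseteq> S \<and> length ys = n}.
      pmf \<mu> z * (\<Prod>i<n. P ((z # ys) ! i) (ys ! i)) * of_bool (R (z # ys)))"
    by (subst sum.cartesian_product[symmetric]) (rule sum.swap)
  also have "\<dots> = (\<Sum>z\<in>S. pmf \<mu> z * path_exp S P (m - 1) z (\<lambda>ys. of_bool (R (z # ys))))"
    by (simp add: m path_exp_eq_sum sum_distrib_left mult.assoc)
  finally show "measure M {\<omega>\<in>space M. R (L \<omega>)}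
         = (\<Sum>z\<in>S. pmf \<mu> z * path_exp S P (m - 1) z (\<lambda>ys. of_bool (R (z # ys))))" .
qed

subsection \<open>Transitions out of a state\<close>

text \<open>The order of the visits is kept, so that the entries can be revealed one at a time as
  draws from the same row. The final state of the list has no successor and is not counted as a
  visit, in agreement with the range t < n in \<open>visits\<close>.\<close>

fun succs :: "'a \<Rightarrow> 'a list \<Rightarrow> 'a list" where
  "succs x (y # z # zs) = (if y = x then z # succs x (z # zs) else succs x (z # zs))"
| "succs x _ = []"

lemma length_succs: "length (succs x l) \<le> length l - 1"
  by (induction x l rule: succs.induct) auto

text \<open>A free predicate \<open>Q\<close> serves both counts: the trivial one gives
  \<open>visits\<close>, equality with a state gives \<open>transitions\<close>. The shift by 1
  translates between trajectories, indexed from 1, and lists, indexed from 0.\<close>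

lemma length_filter_succs:
  "length (filter Q (succs x l)) = card {t. 1 \<le> t \<and> t < length l \<and> l ! (t - 1) = x \<and> Q (l ! t)}"
proof (induction x l rule: succs.induct)
  case (1 x y z zs)
  let ?B = "{t. 1 \<le> t \<and> t < length (z # zs) \<and> (z # zs) ! (t - 1) = x \<and> Q ((z # zs) ! t)}"
  have "{t. 1 \<le> t \<and> t < length (y # z # zs) \<and> (y # z # zs) ! (t - 1) = x \<and> Q ((y # z # zs) ! t)}
      = (if y = x \<and> Q z then {1} else {}) \<union> Suc ` ?B" (is "?A = ?C")
  proof (intro set_eqI)
    fix t
    consider "t = 0" | "t = 1" | t' where "t = Suc (Suc t')" by (metis One_nat_def not0_implies_Suc)
    then show "t \<in> ?A \<longleftrightarrow> t \<in> ?C"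
      by cases (auto simp: image_iff)
  qed
  then have "card ?A = card (if y = x \<and> Q z then {1::nat} else {}) + card ?B"
    by (simp only:) (subst card_Un_disjoint, auto simp: card_image)
  then show ?case using "1.IH" by auto
qed auto

lemma visits_eq_length_succs: "visits (length l) (\<lambda>i. l ! (i - 1)) x = length (succs x l)"
  using length_filter_succs[of "\<lambda>_. True" x l] by (simp add: visits_def)

lemma transitions_eq_count_succs:
  "transitions (length l) (\<lambda>i. l ! (i - 1)) x x' = count_list (succs x l) x'"
proof -
  have "(=) x' = (\<lambda>y. y = x')" by auto
  then show ?thesis
    using length_filter_succs[of "\<lambda>y. y = x'" x l]
    by (simp add: transitions_def count_list_eq_length_filter)
qed

text \<open>The successors of the first visits to a state are independent draws from its row.\<close>

lemma path_exp_succs_le: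
  assumes "row_stochastic S P" "x \<in> S" "z \<in> S" "\<And>l. 0 \<le> g l"
  shows "path_exp S P n z (\<lambda>ys. of_bool (length (succs x (z # ys)) = k) * g (succs x (z # ys)))
         \<le> path_exp S (\<lambda>_. P x) k z g"
  using assms(3,4)
proof (induction n arbitrary: z k g)
  case 0
  have *: "row_stochastic S (\<lambda>_. P x)" using assms(1,2) by (simp add: row_stochastic_def)
  have "0 \<le> path_exp S (\<lambda>_. P x) k z g"
    using path_exp_mono[OF * 0(1), of k "\<lambda>_. 0" g] 0(2) by (simp add: path_exp_zero)
  \<comment> \<open>The inequality is genuine here: a path that ends before the \<open>k\<close>-th
    visit contributes nothing on the left, while the right side is nonnegative.\<close>
  then show ?case by (cases k) auto
next
  case (Suc n)
  have *: "row_stochastic S (\<lambda>_. P x)" using assms(1,2) by (simp add: row_stochastic_def)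
  show ?case
  proof (cases "z = x")
    \<comment> \<open>A step from a state other than \<open>x\<close> reveals no draw. The bound
      after it does not depend on the state reached, so averaging over the row of \<open>z\<close>
      preserves it.\<close>
    case False
    have "path_exp S P (Suc n) z
          (\<lambda>ys. of_bool (length (succs x (z # ys)) = k) * g (succs x (z # ys)))
        = (\<Sum>y\<in>S. P z y * path_exp S P n y
          (\<lambda>ys. of_bool (length (succs x (y # ys)) = k) * g (succs x (y # ys))))"
      using False by simp
    also have "\<dots> \<le> (\<Sum>y\<in>S. P z y * path_exp S (\<lambda>_. P x) k z g)"
    proof (intro sum_mono mult_left_mono row_stochastic_nonneg[OF assms(1) Suc.prems(1)])
      fix y assume "y \<in> S"
      then show "path_exp S P n y
          (\<lambda>ys. of_bool (length (succs x (y # ys)) = k) * g (succs x (y # ys)))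
        \<le> path_exp S (\<lambda>_. P x) k z g"
        using Suc.IH[of y g k] Suc.prems(2) path_exp_const_kernel_indep[of S "P x" k y g z] by simp
    qed
    also have "\<dots> = path_exp S (\<lambda>_. P x) k z g"
      by (simp add: sum_distrib_right[symmetric] row_stochastic_sum[OF assms(1) Suc.prems(1)])
    finally show ?thesis .
  next
    case True
    show ?thesis
    proof (cases k)
      case 0
      then show ?thesis using True Suc.prems by (simp add: path_exp_zero)
    next
      \<comment> \<open>A step from \<open>x\<close> reveals one draw from row \<open>x\<close>; it
        is prepended inside \<open>g\<close>, and one visit fewer remains.\<close>
      case (Suc k')
      have "path_exp S P (Suc n) z
            (\<lambda>ys. of_bool (length (succs x (z # ys)) = k) * g (succs x (z # ys)))
          = (\<Sum>y\<in>S. P x y * path_exp S P n y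
            (\<lambda>ys. of_bool (length (succs x (y # ys)) = k') * g (y # succs x (y # ys))))"
        using True Suc by simp
      also have "\<dots> \<le> (\<Sum>y\<in>S. P x y * path_exp S (\<lambda>_. P x) k' y (\<lambda>l. g (y # l)))"
        by (intro sum_mono mult_left_mono row_stochastic_nonneg[OF assms(1,2)]
            Suc.IH[where g = "\<lambda>l. g (_ # l)"] Suc.prems(2))
      finally show ?thesis using Suc by simp
    qed
  qed
qed

subsection \<open>Concentration of empirical distributions\<close>

lemma row_pmf_exists:
  assumes "finite S" "\<And>y. y \<in> S \<Longrightarrow> 0 \<le> p y" "(\<Sum>y\<in>S. p y) = 1"
  obtains q where "q \<in> distributions S" "\<And>y. y \<in> S \<Longrightarrow> pmf q y = p y"
proof -
  define f where "f = (\<lambda>y. if y \<in> S then p y else 0)"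
  have nn: "0 \<le> f y" for y using assms(2) by (simp add: f_def)
  have "(\<integral>\<^sup>+y. ennreal (f y) \<partial>count_space UNIV) = (\<Sum>y\<in>S. ennreal (f y))"
    by (rule nn_integral_count_space') (auto simp: assms(1) f_def)
  also have "\<dots> = 1"
    using assms(3) by (subst sum_ennreal) (auto simp: nn, simp add: f_def)
  finally have *: "(\<integral>\<^sup>+y. ennreal (f y) \<partial>count_space UNIV) = 1" .
  show ?thesis
  proof
    show "embed_pmf f \<in> distributions S"
      using set_embed_pmf[of f, OF nn *] by (auto simp: distributions_def f_def)
    show "pmf (embed_pmf f) y = p y" if "y \<in> S" for y
      using pmf_embed_pmf[of f, OF nn *] that by (simp add: f_def)
  qed
qed

lemma pmf_sum_distributions:
  assumes "finite S" "q \<in> distributions S"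
  shows "(\<Sum>y\<in>S. pmf q y) = 1"
  using assms sum_pmf_eq_1[of S q] by (simp add: distributions_def)

text \<open>Hoeffding's lemma for one draw. The range of \<open>g\<close> enters through differences
  of its values, since only those are controlled in the bounded difference argument; the row is
  turned into a pmf so that the version for bounded random variables applies.\<close>

lemma hoeffding_row:
  assumes "finite S" "S \<noteq> {}" "row_stochastic S (\<lambda>_. p)" "0 < \<theta>"
    and "\<And>y y'. y \<in> S \<Longrightarrow> y' \<in> S \<Longrightarrow> g y - g y' \<le> c"
  shows "(\<Sum>y\<in>S. p y * exp (\<theta> * g y)) \<le> exp (\<theta> * (\<Sum>y\<in>S. p y * g y) + \<theta>\<^sup>2 * c\<^sup>2 / 8)"
proof -
  have p: "\<And>y. y \<in> S \<Longrightarrow> 0 \<le> p y" "(\<Sum>y\<in>S. p y) = 1"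
    using assms(2,3) by (auto simp: row_stochastic_def)
  from row_pmf_exists[OF assms(1) p]
  obtain q where q: "q \<in> distributions S" "\<And>y. y \<in> S \<Longrightarrow> pmf q y = p y" by blast
  have qS: "set_pmf q \<subseteq> S" using q(1) by (simp add: distributions_def)
  define a b where "a = Min (g ` S)" and "b = Max (g ` S)"
  have ab: "a \<le> g y" "g y \<le> b" if "y \<in> S" for y
    using that assms(1) by (auto simp: a_def b_def)
  have "a \<in> g ` S" "b \<in> g ` S"
    using assms(1,2) by (auto simp: a_def b_def intro!: Min_in Max_in)
  then have "b - a \<le> c" using assms(5) by auto
  moreover have "0 \<le> b - a" using ab assms(2) by fastforce
  ultimately have ba: "(b - a)\<^sup>2 \<le> c\<^sup>2" by (rule power_mono)
  interpret interval_bounded_random_variable "measure_pmf q" g a b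
    by unfold_locales (use qS ab in \<open>auto simp: AE_measure_pmf_iff\<close>)
  define e where "e = (\<Sum>y\<in>S. p y * g y)"
  have sum: "measure_pmf.expectation q h = (\<Sum>y\<in>S. p y * h y)" for h :: "'a \<Rightarrow> real"
    using integral_measure_pmf_real[OF assms(1), of q h] qS q(2)
    by (auto simp: mult.commute intro!: sum.cong)
  have int: "integrable (measure_pmf q) h" for h :: "'a \<Rightarrow> real"
    by (rule integrable_measure_pmf_finite) (rule finite_subset[OF qS assms(1)])
  have "ennreal (\<Sum>y\<in>S. p y * exp (\<theta> * (g y - e)))
      = (\<integral>\<^sup>+y. exp (\<theta> * (g y - e)) \<partial>measure_pmf q)"
    by (subst nn_integral_eq_integral[OF int]) (simp_all add: sum)
  also have "\<dots> \<le> ennreal (exp (\<theta>\<^sup>2 * (b - a)\<^sup>2 / 8))"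
    using Hoeffdings_lemma_nn_integral[OF assms(4)] by (simp add: sum[of g] e_def)
  finally have "(\<Sum>y\<in>S. p y * exp (\<theta> * (g y - e))) \<le> exp (\<theta>\<^sup>2 * (b - a)\<^sup>2 / 8)"
    by (simp add: ennreal_le_iff)
  also have "\<dots> \<le> exp (\<theta>\<^sup>2 * c\<^sup>2 / 8)"
    using ba by (simp add: mult_left_mono)
  finally have "exp (\<theta> * e) * (\<Sum>y\<in>S. p y * exp (\<theta> * (g y - e))) \<le> exp (\<theta> * e) * exp (\<theta>\<^sup>2 * c\<^sup>2 / 8)"
    by (rule mult_left_mono) simp
  moreover have "exp (\<theta> * e) * (\<Sum>y\<in>S. p y * exp (\<theta> * (g y - e))) = (\<Sum>y\<in>S. p y * exp (\<theta> * g y))"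
    unfolding sum_distrib_left by (intro sum.cong) (simp_all add: right_diff_distrib exp_diff)
  ultimately have "(\<Sum>y\<in>S. p y * exp (\<theta> * g y)) \<le> exp (\<theta> * e) * exp (\<theta>\<^sup>2 * c\<^sup>2 / 8)"
    by (simp only:)
  then show ?thesis by (simp add: e_def exp_add)
qed

text \<open>Conditioning on the first draw \<open>y\<close> leaves the function
  \<open>f (y # _)\<close> of the remaining draws, which the induction covers; its conditional mean
  \<open>g y\<close> oscillates by at most \<open>c\<close>, so Hoeffding's lemma handles the first
  draw. The result is kept in the form of a moment generating function, to be optimized in \<theta>
  later.\<close>

lemma mcdiarmid:
  assumes "finite S" "row_stochastic S (\<lambda>_. p)" "0 < \<theta>" "z \<in> S"
    and "\<And>l y y' r. \<lbrakk>set l \<subseteq> S; set r \<subseteq> S; y \<in> S; y' \<in> S; length l + length r + 1 = k\<rbrakk>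
           \<Longrightarrow> f (l @ y # r) - f (l @ y' # r) \<le> c"
  shows "path_exp S (\<lambda>_. p) k z (\<lambda>l. exp (\<theta> * f l))
         \<le> exp (\<theta> * path_exp S (\<lambda>_. p) k z f + real k * (\<theta>\<^sup>2 * c\<^sup>2 / 8))"
  using assms(4,5)
proof (induction k arbitrary: z f)
  case 0
  then show ?case by simp
next
  case (Suc k)
  define g where "g = (\<lambda>y. path_exp S (\<lambda>_. p) k z (\<lambda>l. f (y # l)))"
  have p: "0 \<le> p y" if "y \<in> S" for y
    using assms(2) Suc.prems(1) that by (auto simp: row_stochastic_def)
  have g_diff: "g y - g y' \<le> c" if "y \<in> S" "y' \<in> S" for y y'
  proof -
    have "g y - g y' = path_exp S (\<lambda>_. p) k z (\<lambda>l. f (y # l) - f (y' # l))"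
      by (simp add: g_def path_exp_diff)
    also have "\<dots> \<le> path_exp S (\<lambda>_. p) k z (\<lambda>_. c)"
      using that Suc.prems(2)[of "[]" _ y y']
      by (intro path_exp_mono[OF assms(2) Suc.prems(1)]) auto
    finally show ?thesis by (simp add: path_exp_const[OF assms(2) Suc.prems(1)])
  qed
  have step: "path_exp S (\<lambda>_. p) k z (\<lambda>l. exp (\<theta> * f (y # l)))
      \<le> exp (\<theta> * g y + real k * (\<theta>\<^sup>2 * c\<^sup>2 / 8))" if "y \<in> S" for y
    unfolding g_def
  proof (rule Suc.IH[OF Suc.prems(1)])
    fix l r w w' assume "set l \<subseteq> S" "set r \<subseteq> S" "w \<in> S" "w' \<in> S" "length l + length r + 1 = k"
    then show "f (y # l @ w # r) - f (y # l @ w' # r) \<le> c"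
      using Suc.prems(2)[of "y # l" r w w'] that by simp
  qed
  have "path_exp S (\<lambda>_. p) (Suc k) z (\<lambda>l. exp (\<theta> * f l))
      = (\<Sum>y\<in>S. p y * path_exp S (\<lambda>_. p) k z (\<lambda>l. exp (\<theta> * f (y # l))))"
    unfolding path_exp.simps
    by (intro sum.cong refl arg_cong2[where f = "(*)"] path_exp_const_kernel_indep)
  also have "\<dots> \<le> (\<Sum>y\<in>S. p y * exp (\<theta> * g y + real k * (\<theta>\<^sup>2 * c\<^sup>2 / 8)))"
    by (intro sum_mono mult_left_mono step p)
  also have "\<dots> = (\<Sum>y\<in>S. p y * exp (\<theta> * g y)) * exp (real k * (\<theta>\<^sup>2 * c\<^sup>2 / 8))"
    by (simp add: exp_add sum_distrib_right mult.assoc)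
  also have "\<dots> \<le> exp (\<theta> * (\<Sum>y\<in>S. p y * g y) + \<theta>\<^sup>2 * c\<^sup>2 / 8) * exp (real k * (\<theta>\<^sup>2 * c\<^sup>2 / 8))"
    using Suc.prems(1) by (intro mult_right_mono hoeffding_row assms g_diff) auto
  also have "(\<Sum>y\<in>S. p y * g y) = path_exp S (\<lambda>_. p) (Suc k) z f"
    unfolding path_exp.simps g_def
    by (intro sum.cong refl arg_cong2[where f = "(*)"] path_exp_const_kernel_indep)
  finally show ?case by (simp add: exp_add[symmetric] algebra_simps add_divide_distrib del: path_exp.simps)
qed

text \<open>A quadratic majorant that vanishes in expectation for a count with mean \<open>b\<close> and
  variance at most \<open>b\<close>; it replaces the symmetrization argument.\<close>

lemma half_deviation_quadratic_bound:
  fixes b :: real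
  assumes "0 \<le> b"
  obtains \<alpha> \<beta> where "0 \<le> \<beta>"
    "\<And>n::nat. \<bar>real n - b\<bar> / 2 - sqrt (real n) \<le> \<alpha> * (real n - b) + \<beta> * ((real n - b)\<^sup>2 - b)"
proof (cases "b \<le> 1")
  case True
  \<comment> \<open>With \<beta> = 1/2, this \<alpha> gives equality at n = 0. The majorant becomes
    ((n - b)(n - 2) - b)/2, which is checked one by one at n = 0, 1, 2 and by the sign of (n - b)(n
    - 3) from 3 on.\<close>
  have "\<bar>real n - b\<bar> / 2 - sqrt (real n)
      \<le> (b - 2) / 2 * (real n - b) + 1 / 2 * ((real n - b)\<^sup>2 - b)" for n :: nat
  proof -
    have eq: "(b - 2) / 2 * (real n - b) + 1 / 2 * ((real n - b)\<^sup>2 - b)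
        = ((real n - b) * (real n - 2) - b) / 2"
      by (simp add: power2_eq_square field_simps)
    consider "n = 0" | "n = 1" | "n = 2" | "3 \<le> n" by linarith
    then show ?thesis
    proof cases
      case 1
      then show ?thesis unfolding eq using assms by simp
    next
      case 2
      then show ?thesis unfolding eq using assms True by (simp add: abs_le_iff field_simps)
    next
      case 3
      then show ?thesis unfolding eq using assms True by (simp add: field_simps)
    next
      case 4
      have aux: "u / 2 - s \<le> (v + u - b) / 2" if "0 \<le> v" "1 \<le> s" for u v s :: real
        using that True by (simp add: field_simps)
      have "\<bar>real n - b\<bar> / 2 - sqrt (real n) = (real n - b) / 2 - sqrt (real n)"
        using 4 True by simp
      also have "\<dots> \<le> ((real n - b) * (real n - 3) + (real n - b) - b) / 2"
        using 4 True by (intro aux) simp_all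
      also have "(real n - b) * (real n - 3) + (real n - b) = (real n - b) * (real n - 2)"
        by (simp add: algebra_simps)
      finally show ?thesis unfolding eq .
    qed
  qed
  then show ?thesis by (intro that[of "1 / 2" "(b - 2) / 2"]) simp_all
next
  case False
  define r where "r = sqrt b"
  have r: "1 \<le> r" "b = r\<^sup>2" using False assms by (auto simp: r_def)
  \<comment> \<open>The sum of two estimates on the scale r = sqrt b, with d = n - b: |d|/2 \<le>
    d^2/(4r) + r/4 by the inequality of means, and sqrt n \<ge> r + d/(2r) - d^2/(2r^3), the tangent
    of the square root at b with a quadratic correction. The remaining constant r/4 - r is at most
    -\<beta> b = -r/4 - 1/(2r) because r \<ge> 1.\<close>
  define \<alpha> \<beta> where "\<alpha> = - 1 / (2 * r)" and "\<beta> = 1 / (4 * r) + 1 / (2 * r ^ 3)"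
  have "\<bar>real n - b\<bar> / 2 - sqrt (real n) \<le> \<alpha> * (real n - b) + \<beta> * ((real n - b)\<^sup>2 - b)" for n :: nat
  proof -
    define d where "d = real n - b"
    define w where "w = sqrt (real n) / r"
    have w: "0 \<le> w" "sqrt (real n) = w * r" using r(1) by (auto simp: w_def)
    have "real n = (w * r)\<^sup>2" using w(2) by (metis of_nat_0_le_iff real_sqrt_pow2)
    then have d: "d = r\<^sup>2 * (w\<^sup>2 - 1)"
      by (simp add: d_def r(2) power_mult_distrib algebra_simps)
    have "0 \<le> (\<bar>d\<bar> - r)\<^sup>2" by simp
    then have "2 * \<bar>d\<bar> * r \<le> d\<^sup>2 + r\<^sup>2" by (simp add: power2_diff)
    then have 1: "\<bar>d\<bar> / 2 \<le> d\<^sup>2 / (4 * r) + r / 4"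
      using r(1) by (simp add: field_simps power2_eq_square)
    \<comment> \<open>In the ratio w = sqrt (n/b) the estimate for the square root reads 1 + u/2 -
      u^2/2 \<le> w with u = w^2 - 1; twice the difference of the sides factors as (w - 1)^2 w (w +
      2).\<close>
    have "(w + 1)\<^sup>2 - 1 = w * (w + 2)" by (simp add: power2_eq_square algebra_simps)
    then have "0 \<le> (w - 1)\<^sup>2 * ((w + 1)\<^sup>2 - 1)" using w(1) by simp
    also have "\<dots> = 2 * w - 2 - (w\<^sup>2 - 1) + (w\<^sup>2 - 1)\<^sup>2"
      by (simp add: power2_eq_square algebra_simps)
    finally have *: "0 \<le> 2 * w - 2 - (w\<^sup>2 - 1) + (w\<^sup>2 - 1)\<^sup>2" .
    have "1 + u / 2 - v / 2 \<le> w" if "0 \<le> 2 * w - 2 - u + v" for u v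
      using that by (simp add: field_simps)
    from this[OF *] have "1 + (w\<^sup>2 - 1) / 2 - (w\<^sup>2 - 1)\<^sup>2 / 2 \<le> w" .
    then have "(1 + (w\<^sup>2 - 1) / 2 - (w\<^sup>2 - 1)\<^sup>2 / 2) * r \<le> w * r"
      using r(1) by (intro mult_right_mono) auto
    also have "(1 + (w\<^sup>2 - 1) / 2 - (w\<^sup>2 - 1)\<^sup>2 / 2) * r = r + d / (2 * r) - d\<^sup>2 / (2 * r ^ 3)"
      unfolding d using r(1) by (simp add: field_simps power2_eq_square power3_eq_cube)
    finally have 2: "r + d / (2 * r) - d\<^sup>2 / (2 * r ^ 3) \<le> sqrt (real n)" using w(2) by simp
    have "\<beta> * b = r / 4 + 1 / (2 * r)"
      unfolding \<beta>_def r(2) using r(1) by (simp add: field_simps power2_eq_square power3_eq_cube)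
    moreover have "1 / (2 * r) \<le> r / 2"
      using r(1) mult_mono[of 1 r 1 r] by (simp add: field_simps)
    ultimately have 3: "\<beta> * b \<le> 3 * r / 4" by simp
    have "\<alpha> * d + \<beta> * (d\<^sup>2 - b) = - (d / (2 * r)) + d\<^sup>2 / (4 * r) + d\<^sup>2 / (2 * r ^ 3) - \<beta> * b"
      unfolding right_diff_distrib by (simp add: \<alpha>_def \<beta>_def distrib_right)
    then show ?thesis using 1 2 3 unfolding d_def[symmetric] by linarith
  qed
  moreover have "0 \<le> \<beta>" using r(1) by (simp add: \<beta>_def)
  ultimately show ?thesis using that by blast
qed

section \<open>Moments of the counts of independent draws\<close>

lemma path_exp_count_mean:
  assumes "finite S" "row_stochastic S (\<lambda>_. p)" "x \<in> S" "z \<in> S"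
  shows "path_exp S (\<lambda>_. p) k z (\<lambda>l. real (count_list l x)) = real k * p x"
  using assms(4)
proof (induction k arbitrary: z)
  case (Suc k)
  have sum1: "(\<Sum>y\<in>S. p y) = 1" using assms(2,3) by (auto simp: row_stochastic_def)
  have "path_exp S (\<lambda>_. p) k y (\<lambda>l. real (count_list (y # l) x)) = of_bool (y = x) + real k * p x"
    if "y \<in> S" for y
    using Suc.IH[OF that] path_exp_add[of S "\<lambda>_. p" k y "\<lambda>_. 1" "\<lambda>l. real (count_list l x)"]
      path_exp_const[OF assms(2) that, of k 1]
    by (cases "y = x") (simp_all add: add.commute)
  then have "path_exp S (\<lambda>_. p) (Suc k) z (\<lambda>l. real (count_list l x))
      = (\<Sum>y\<in>S. p y * (of_bool (y = x) + real k * p x))"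
    unfolding path_exp.simps by (intro sum.cong) auto
  also have "\<dots> = (\<Sum>y\<in>S. p y * of_bool (y = x)) + (\<Sum>y\<in>S. p y) * (real k * p x)"
    by (simp add: distrib_left sum.distrib sum_distrib_right)
  also have "(\<Sum>y\<in>S. p y * of_bool (y = x)) = p x"
    using assms(1,3) by (simp add: of_bool_def if_distrib[of "\<lambda>u. _ * u"] cong: if_cong)
  finally show ?case by (simp add: sum1 algebra_simps)
qed simp

lemma path_exp_count_variance:
  assumes "finite S" "row_stochastic S (\<lambda>_. p)" "x \<in> S" "z \<in> S"
  shows "path_exp S (\<lambda>_. p) k z (\<lambda>l. (real (count_list l x) - real k * p x)\<^sup>2)
         = real k * (p x * (1 - p x))"
  using assms(4)
proof (induction k arbitrary: z)
  case (Suc k)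
  have sum1: "(\<Sum>y\<in>S. p y) = 1" using assms(2,3) by (auto simp: row_stochastic_def)
  define D where "D = (\<lambda>l. real (count_list l x) - real k * p x)"
  have "path_exp S (\<lambda>_. p) k y (\<lambda>l. (real (count_list (y # l) x) - real (Suc k) * p x)\<^sup>2)
      = (of_bool (y = x) - p x)\<^sup>2 + real k * (p x * (1 - p x))" if "y \<in> S" for y
  proof -
    define u :: real where "u = of_bool (y = x) - p x"
    have "(real (count_list (y # l) x) - real (Suc k) * p x)\<^sup>2 = u\<^sup>2 + 2 * u * D l + (D l)\<^sup>2" for l
    proof -
      have "real (count_list (y # l) x) - real (Suc k) * p x = u + D l"
        by (simp add: u_def D_def algebra_simps)
      then show ?thesis by (simp add: power2_sum algebra_simps)
    qed
    moreover have "path_exp S (\<lambda>_. p) k y D = 0"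
      by (simp add: D_def path_exp_diff path_exp_count_mean[OF assms(1-3) that]
          path_exp_const[OF assms(2) that])
    ultimately show ?thesis
      using Suc.IH[OF that]
      by (simp only: path_exp_add path_exp_cmult path_exp_const[OF assms(2) that])
        (simp add: D_def u_def)
  qed
  then have "path_exp S (\<lambda>_. p) (Suc k) z (\<lambda>l. (real (count_list l x) - real (Suc k) * p x)\<^sup>2)
      = (\<Sum>y\<in>S. p y * ((of_bool (y = x) - p x)\<^sup>2 + real k * (p x * (1 - p x))))"
    unfolding path_exp.simps by (intro sum.cong) auto
  also have "\<dots> = (\<Sum>y\<in>S. p y * of_bool (y = x) * (1 - 2 * p x) + p y * ((p x)\<^sup>2 + real k * (p x * (1 - p x))))"
    by (intro sum.cong) (auto simp: power2_eq_square algebra_simps)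
  also have "\<dots> = (\<Sum>y\<in>S. p y * of_bool (y = x)) * (1 - 2 * p x)
      + (\<Sum>y\<in>S. p y) * ((p x)\<^sup>2 + real k * (p x * (1 - p x)))"
    by (simp only: sum.distrib sum_distrib_right)
  also have "(\<Sum>y\<in>S. p y * of_bool (y = x)) = p x"
    using assms(1,3) by (simp add: of_bool_def if_distrib[of "\<lambda>u. _ * u"] cong: if_cong)
  finally show ?case by (simp add: sum1 power2_eq_square algebra_simps)
qed simp

text \<open>Scaled by the sample size, so that the empty sample needs no convention. The subtracted
  sum is the first term in the numerator of \<open>W_hat\<close>: a penalty computed from the data
  that compensates the mean of the deviation.\<close>

definition tv_excess :: "'a set \<Rightarrow> ('a \<Rightarrow> real) \<Rightarrow> 'a list \<Rightarrow> real" where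
  "tv_excess S p l = (\<Sum>x\<in>S. \<bar>real (count_list l x) - real (length l) * p x\<bar> / 2
                              - sqrt (real (count_list l x)))"

lemma tv_excess_mean_nonpos:
  assumes "finite S" "row_stochastic S (\<lambda>_. p)" "z \<in> S"
  shows "path_exp S (\<lambda>_. p) k z (tv_excess S p) \<le> 0"
proof -
  have "path_exp S (\<lambda>_. p) k z (tv_excess S p) = path_exp S (\<lambda>_. p) k z
      (\<lambda>l. \<Sum>x\<in>S. \<bar>real (count_list l x) - real k * p x\<bar> / 2 - sqrt (real (count_list l x)))"
    by (rule path_exp_cong) (simp add: tv_excess_def)
  also have "\<dots> = (\<Sum>x\<in>S. path_exp S (\<lambda>_. p) k z
      (\<lambda>l. \<bar>real (count_list l x) - real k * p x\<bar> / 2 - sqrt (real (count_list l x))))"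
    by (rule path_exp_sum[OF assms(1)])
  also have "\<dots> \<le> (\<Sum>x\<in>S. 0)"
  proof (rule sum_mono)
    fix x assume x: "x \<in> S"
    have p: "0 \<le> p x" using assms(2) x by (auto simp: row_stochastic_def)
    define b where "b = real k * p x"
    have "0 \<le> b" using p by (simp add: b_def)
    from half_deviation_quadratic_bound[OF this] obtain \<alpha> \<beta> where \<beta>: "0 \<le> \<beta>" and
      bound: "\<And>n::nat. \<bar>real n - b\<bar> / 2 - sqrt (real n)
                \<le> \<alpha> * (real n - b) + \<beta> * ((real n - b)\<^sup>2 - b)" by blast
    have "path_exp S (\<lambda>_. p) k z
        (\<lambda>l. \<bar>real (count_list l x) - b\<bar> / 2 - sqrt (real (count_list l x)))
      \<le> path_exp S (\<lambda>_. p) k z (\<lambda>l. \<alpha> * (real (count_list l x) - b)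
          + \<beta> * ((real (count_list l x) - b)\<^sup>2 - b))"
      by (intro path_exp_mono assms bound)
    \<comment> \<open>The linear term has mean 0 and the quadratic one has mean -\<beta> k (p x)^2,
      so the sign of \<beta> decides.\<close>
    also have "\<dots> = \<beta> * (real k * (p x * (1 - p x)) - b)"
      by (simp only: path_exp_add path_exp_cmult path_exp_diff path_exp_const[OF assms(2,3)]
          path_exp_count_mean[OF assms(1,2) x assms(3)] b_def
          path_exp_count_variance[OF assms(1,2) x assms(3)]) simp
    also have "\<dots> \<le> 0"
      using \<beta> by (intro mult_nonneg_nonpos) (auto simp: b_def algebra_simps)
    finally show "path_exp S (\<lambda>_. p) k z
        (\<lambda>l. \<bar>real (count_list l x) - real k * p x\<bar> / 2 - sqrt (real (count_list l x))) \<le> 0"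
      by (simp add: b_def)
  qed
  finally show ?thesis by simp
qed

lemma tv_excess_bounded_difference:
  assumes "finite S" "y \<in> S" "y' \<in> S"
  shows "tv_excess S p (l @ y # r) - tv_excess S p (l @ y' # r) \<le> 2"
proof -
  define k where "k = length l + length r + 1"
  define c where "c = (\<lambda>x. count_list l x + count_list r x)"
  define \<psi> where "\<psi> = (\<lambda>x n. \<bar>real n - real k * p x\<bar> / 2 - sqrt (real n))"
  have eq: "tv_excess S p (l @ w # r) = (\<Sum>x\<in>S. \<psi> x (c x)) + (\<psi> w (Suc (c w)) - \<psi> w (c w))"
    if "w \<in> S" for w
  proof -
    have "tv_excess S p (l @ w # r) = (\<Sum>x\<in>S. \<psi> x (if x = w then Suc (c x) else c x))"
      unfolding tv_excess_def \<psi>_def k_def c_def by (intro sum.cong) (auto simp: add_ac)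
    also have "\<dots> = (\<Sum>x\<in>S. \<psi> x (c x) + (if x = w then \<psi> w (Suc (c w)) - \<psi> w (c w) else 0))"
      by (intro sum.cong) auto
    also have "\<dots> = (\<Sum>x\<in>S. \<psi> x (c x)) + (\<psi> w (Suc (c w)) - \<psi> w (c w))"
      using assms(1) that by (simp add: sum.distrib)
    finally show ?thesis .
  qed
  \<comment> \<open>Raising a count by 1 moves the half deviation by at most 1/2 either way and the
    square root up by at most 1, so the increment of \<open>\<psi>\<close> lies in [-3/2, 1/2]. The
    constant 2 is the length of this interval.\<close>
  have "\<bar>\<psi> w (Suc n) - \<psi> w n + 1 / 2\<bar> \<le> 1" for w n
  proof -
    have "sqrt (real (Suc n)) \<le> sqrt (real n) + 1"
      using sqrt_add_le_add_sqrt[of "real n" 1] by (simp add: add.commute)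
    moreover have "sqrt (real n) \<le> sqrt (real (Suc n))" by simp
    moreover have "\<bar>\<bar>real (Suc n) - a\<bar> - \<bar>real n - a\<bar>\<bar> \<le> 1" for a by simp
    ultimately show ?thesis unfolding \<psi>_def abs_le_iff[of _ 1] by (smt (verit) field_sum_of_halves)
  qed
  from this[of y "c y"] this[of y' "c y'"] show ?thesis
    unfolding eq[OF assms(2)] eq[OF assms(3)] by linarith
qed

lemma tv_excess_tail:
  assumes "finite S" "row_stochastic S (\<lambda>_. p)" "z \<in> S" "1 \<le> k" "0 \<le> L"
  shows "path_exp S (\<lambda>_. p) k z
           (\<lambda>l. of_bool (3 / sqrt 2 * sqrt (real k) * sqrt L < tv_excess S p l)) \<le> exp (- L)"
proof (cases "L = 0")
  \<comment> \<open>At L = 0 the parameter \<open>\<theta>\<close> chosen below would be 0, which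
    \<open>mcdiarmid\<close> excludes; the bound is then 1 and trivial.\<close>
  case True
  have "path_exp S (\<lambda>_. p) k z
      (\<lambda>l. of_bool (3 / sqrt 2 * sqrt (real k) * sqrt L < tv_excess S p l))
      \<le> path_exp S (\<lambda>_. p) k z (\<lambda>_. 1)"
    by (intro path_exp_mono assms) auto
  then show ?thesis using True by (simp add: path_exp_const[OF assms(2,3)])
next
  case False
  define t where "t = 3 / sqrt 2 * sqrt (real k) * sqrt L"
  \<comment> \<open>Minimizes -\<theta> t + k \<theta>^2/2, the Chernoff exponent for differences
    bounded by 2. The minimum -t^2/(2k) equals -9L/4, which is below the required -L.\<close>
  define \<theta> where "\<theta> = t / real k"
  have t: "0 < t" "t\<^sup>2 = 9 / 2 * real k * L"
    using False assms(4,5) by (auto simp: t_def power_mult_distrib power_divide)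
  have \<theta>: "0 < \<theta>" using t assms(4) by (simp add: \<theta>_def)
  have "path_exp S (\<lambda>_. p) k z (\<lambda>l. of_bool (t < tv_excess S p l))
      \<le> path_exp S (\<lambda>_. p) k z (\<lambda>l. exp (- \<theta> * t) * exp (\<theta> * tv_excess S p l))"
    using \<theta> by (intro path_exp_mono assms) (auto simp: exp_add[symmetric])
  also have "\<dots> = exp (- \<theta> * t) * path_exp S (\<lambda>_. p) k z (\<lambda>l. exp (\<theta> * tv_excess S p l))"
    by (rule path_exp_cmult)
  also have "\<dots> \<le> exp (- \<theta> * t)
      * exp (\<theta> * path_exp S (\<lambda>_. p) k z (tv_excess S p) + real k * (\<theta>\<^sup>2 * 2\<^sup>2 / 8))"
    by (intro mult_left_mono mcdiarmid assms \<theta> tv_excess_bounded_difference) auto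
  also have "\<dots> \<le> exp (- \<theta> * t) * exp (0 + real k * (\<theta>\<^sup>2 * 2\<^sup>2 / 8))"
    using tv_excess_mean_nonpos[OF assms(1-3), of k] \<theta>
    by (intro mult_left_mono) (auto simp: mult_nonneg_nonpos)
  also have "\<dots> = exp (- (t\<^sup>2 / (2 * real k)))"
    using assms(4) by (simp add: exp_add[symmetric] \<theta>_def field_simps power2_eq_square)
  also have "\<dots> \<le> exp (- L)"
  proof -
    have "0 \<le> real k * L" using assms(5) by simp
    then have "L * (2 * real k) \<le> t\<^sup>2" using t(2) by (simp add: mult.commute)
    then show ?thesis using assms(4) by (simp add: pos_le_divide_eq)
  qed
  finally show ?thesis by (simp add: t_def)
qed

text \<open>When the event occurs at a state, that state has between 1 and n - 1 visits. Thus |S| (n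
  - 1) pairs of state and count matter, each of probability at most exp (-L) = d/(2n|S|).\<close>

lemma chain_tv_excess_tail:
  assumes "finite S" "row_stochastic S P" "z \<in> S" "1 \<le> n" "0 < d" "d \<le> 1"
  shows "path_exp S P (n - 1) z (\<lambda>ys. of_bool (\<exists>x\<in>S.
           3 / sqrt 2 * sqrt (real (length (succs x (z # ys))))
             * sqrt (ln (2 * real n * real (card S) / d))
           < tv_excess S (P x) (succs x (z # ys)))) \<le> d / 2"
proof -
  define L where "L = ln (2 * real n * real (card S) / d)"
  define g where "g = (\<lambda>x k l. of_bool (3 / sqrt 2 * sqrt (real k) * sqrt L < tv_excess S (P x) l) :: real)"
  have "0 < card S" using assms(1,3) by (auto simp: card_gt_0_iff)
  then have card: "1 \<le> real (card S)" by simp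
  have "1 * 1 \<le> real n * real (card S)" using assms(4) card by (intro mult_mono) auto
  then have arg: "1 \<le> 2 * real n * real (card S) / d" using assms(5,6) by (simp add: field_simps)
  then have L: "0 \<le> L" by (simp add: L_def)
  have expL: "exp (- L) = d / (2 * real n * real (card S))"
    unfolding L_def using arg by (subst exp_minus, subst exp_ln) auto
  have "path_exp S P (n - 1) z (\<lambda>ys. of_bool (\<exists>x\<in>S.
         3 / sqrt 2 * sqrt (real (length (succs x (z # ys)))) * sqrt L
           < tv_excess S (P x) (succs x (z # ys))))
      \<le> path_exp S P (n - 1) z (\<lambda>ys. of_bool (\<exists>i\<in>S\<times>{1..<n}.
         length (succs (fst i) (z # ys)) = snd i \<and>
         3 / sqrt 2 * sqrt (real (snd i)) * sqrt L < tv_excess S (P (fst i)) (succs (fst i) (z # ys))))"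
  proof (intro path_exp_mono assms)
    fix ys :: "'a list" assume ys: "length ys = n - 1"
    have "length (succs x (z # ys)) < n" for x
      using length_succs[of x "z # ys"] ys assms(4) by simp
    \<comment> \<open>An unvisited state has excess 0 and threshold 0, so the strict inequality
      fails for it.\<close>
    moreover have "1 \<le> length (succs x (z # ys))"
      if "3 / sqrt 2 * sqrt (real (length (succs x (z # ys)))) * sqrt L
           < tv_excess S (P x) (succs x (z # ys))" for x
      using that by (cases "succs x (z # ys)") (auto simp: tv_excess_def)
    ultimately show "of_bool (\<exists>x\<in>S. 3 / sqrt 2 * sqrt (real (length (succs x (z # ys)))) * sqrt L
           < tv_excess S (P x) (succs x (z # ys)))
      \<le> (of_bool (\<exists>i\<in>S\<times>{1..<n}. length (succs (fst i) (z # ys)) = snd i \<and>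
         3 / sqrt 2 * sqrt (real (snd i)) * sqrt L
           < tv_excess S (P (fst i)) (succs (fst i) (z # ys))) :: real)"
      by fastforce
  qed
  also have "\<dots> \<le> (\<Sum>i\<in>S\<times>{1..<n}. path_exp S P (n - 1) z (\<lambda>ys. of_bool (
         length (succs (fst i) (z # ys)) = snd i \<and>
         3 / sqrt 2 * sqrt (real (snd i)) * sqrt L < tv_excess S (P (fst i)) (succs (fst i) (z # ys)))))"
    by (intro path_exp_of_bool_Bex_le assms) (simp add: assms(1))
  also have "\<dots> = (\<Sum>i\<in>S\<times>{1..<n}. path_exp S P (n - 1) z (\<lambda>ys. of_bool (
         length (succs (fst i) (z # ys)) = snd i) * g (fst i) (snd i) (succs (fst i) (z # ys))))"
    by (simp only: of_bool_conj g_def)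
  also have "\<dots> \<le> (\<Sum>i\<in>S\<times>{1..<n}. d / (2 * real n * real (card S)))"
  proof (rule sum_mono)
    fix i assume i: "i \<in> S\<times>{1..<n}"
    have row: "row_stochastic S (\<lambda>_. P (fst i))" using assms(2) i by (auto simp: row_stochastic_def)
    have "path_exp S P (n - 1) z (\<lambda>ys. of_bool (
         length (succs (fst i) (z # ys)) = snd i) * g (fst i) (snd i) (succs (fst i) (z # ys)))
       \<le> path_exp S (\<lambda>_. P (fst i)) (snd i) z (g (fst i) (snd i))"
      using i by (intro path_exp_succs_le assms) (auto simp: g_def)
    also have "\<dots> \<le> exp (- L)"
      unfolding g_def using i by (intro tv_excess_tail assms row L) auto
    finally show "path_exp S P (n - 1) z (\<lambda>ys. of_bool (
         length (succs (fst i) (z # ys)) = snd i) * g (fst i) (snd i) (succs (fst i) (z # ys)))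
       \<le> d / (2 * real n * real (card S))" by (simp add: expL)
  qed
  also have "\<dots> = real (card S) * real (n - 1) * (d / (2 * real n * real (card S)))"
    by (simp add: card_cartesian_product)
  also have "\<dots> = d / 2 * (real (n - 1) / real n)" using card by (simp add: field_simps)
  also have "\<dots> \<le> d / 2 * 1"
    using assms(4,5) by (intro mult_left_mono) (auto simp: field_simps)
  finally show ?thesis by (simp add: L_def)
qed

subsection \<open>Contraction coefficients\<close>

lemma distributions_nonempty: "S \<noteq> {} \<Longrightarrow> distributions S \<noteq> {}"
proof -
  assume "S \<noteq> {}"
  then obtain x where "x \<in> S" by blast
  then have "return_pmf x \<in> distributions S" by (simp add: distributions_def)
  then show ?thesis by blast
qed

text \<open>A real supremum carries information only over a bounded set, so this underlies every
  lower bound on \<open>kappa\<close>.\<close>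

lemma tv_vec_mat_bdd_above:
  assumes "finite S"
  shows "bdd_above ((\<lambda>(\<mu>, \<nu>). tv_dist S (vec_mat S \<mu> Q) (vec_mat S \<nu> Q)) `
           (distributions S \<times> distributions S))"
proof -
  have vm: "\<bar>vec_mat S \<mu> Q y\<bar> \<le> (\<Sum>x\<in>S. \<bar>Q x y\<bar>)" for \<mu> y
    unfolding vec_mat_def
    by (rule order_trans[OF sum_abs])
       (auto intro!: sum_mono mult_left_le_one_le simp: abs_mult pmf_le_1)
  have "tv_dist S (vec_mat S \<mu> Q) (vec_mat S \<nu> Q) \<le> (\<Sum>y\<in>S. \<Sum>x\<in>S. \<bar>Q x y\<bar>)" for \<mu> \<nu>
  proof -
    have "(\<Sum>y\<in>S. \<bar>vec_mat S \<mu> Q y - vec_mat S \<nu> Q y\<bar>) \<le> (\<Sum>y\<in>S. 2 * (\<Sum>x\<in>S. \<bar>Q x y\<bar>))"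
      using vm[of \<mu>] vm[of \<nu>] by (intro sum_mono) (smt (verit))
    then show ?thesis by (simp add: tv_dist_def sum_distrib_left[symmetric])
  qed
  then show ?thesis by (intro bdd_aboveI2) auto
qed

lemma kappa_least:
  assumes "S \<noteq> {}"
    and "\<And>\<mu> \<nu>. \<mu> \<in> distributions S \<Longrightarrow> \<nu> \<in> distributions S
           \<Longrightarrow> tv_dist S (vec_mat S \<mu> Q) (vec_mat S \<nu> Q) \<le> c"
  shows "kappa S Q \<le> c"
  unfolding kappa_def using distributions_nonempty[OF assms(1)] assms(2)
  by (intro cSUP_least) auto

lemma tv_le_kappa:
  assumes "finite S" "\<mu> \<in> distributions S" "\<nu> \<in> distributions S"
  shows "tv_dist S (vec_mat S \<mu> Q) (vec_mat S \<nu> Q) \<le> kappa S Q"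
  unfolding kappa_def
  using cSUP_upper[OF _ tv_vec_mat_bdd_above[OF assms(1), of Q], of "(\<mu>, \<nu>)"] assms(2,3) by simp

lemma kappa_nonneg:
  assumes "finite S" "S \<noteq> {}"
  shows "0 \<le> kappa S Q"
proof -
  obtain \<mu> where "\<mu> \<in> distributions S" using distributions_nonempty[OF assms(2)] by blast
  from tv_le_kappa[OF assms(1) this this, of Q] show ?thesis by (simp add: tv_dist_def)
qed

lemma sum_abs_vec_mat_le:
  assumes "finite S" "\<mu> \<in> distributions S" "\<And>x. x \<in> S \<Longrightarrow> (\<Sum>y\<in>S. \<bar>Q x y\<bar>) \<le> c"
  shows "(\<Sum>y\<in>S. \<bar>vec_mat S \<mu> Q y\<bar>) \<le> c"
proof -
  have "(\<Sum>y\<in>S. \<bar>vec_mat S \<mu> Q y\<bar>) \<le> (\<Sum>y\<in>S. \<Sum>x\<in>S. pmf \<mu> x * \<bar>Q x y\<bar>)"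
    unfolding vec_mat_def by (intro sum_mono order_trans[OF sum_abs]) (simp add: abs_mult)
  also have "\<dots> = (\<Sum>x\<in>S. pmf \<mu> x * (\<Sum>y\<in>S. \<bar>Q x y\<bar>))"
    by (subst sum.swap) (simp add: sum_distrib_left)
  also have "\<dots> \<le> (\<Sum>x\<in>S. pmf \<mu> x * c)"
    by (intro sum_mono mult_left_mono assms(3)) auto
  also have "\<dots> = c"
    by (simp add: sum_distrib_right[symmetric] pmf_sum_distributions[OF assms(1,2)])
  finally show ?thesis .
qed

lemma kappa_le_1:
  assumes "finite S" "S \<noteq> {}" "row_stochastic S Q"
  shows "kappa S Q \<le> 1"
proof (rule kappa_least[OF assms(2)])
  fix \<mu> \<nu> assume \<mu>: "\<mu> \<in> distributions S" and \<nu>: "\<nu> \<in> distributions S"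
  have row: "(\<Sum>y\<in>S. \<bar>Q x y\<bar>) \<le> 1" if "x \<in> S" for x
    using assms(3) that by (simp add: row_stochastic_def)
  have "(\<Sum>y\<in>S. \<bar>vec_mat S \<mu> Q y - vec_mat S \<nu> Q y\<bar>)
      \<le> (\<Sum>y\<in>S. \<bar>vec_mat S \<mu> Q y\<bar> + \<bar>vec_mat S \<nu> Q y\<bar>)"
    by (intro sum_mono abs_triangle_ineq4)
  also have "\<dots> \<le> 1 + 1"
    unfolding sum.distrib by (intro add_mono sum_abs_vec_mat_le assms \<mu> \<nu> row)
  finally show "tv_dist S (vec_mat S \<mu> Q) (vec_mat S \<nu> Q) \<le> 1" by (simp add: tv_dist_def)
qed

text \<open>Writing A = B + E, linearity splits the difference of the images into that under
  \<open>B\<close> and the images of \<mu> and \<nu> under E. Each of the latter has l1 norm at most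
  \<open>c\<close>, and the factor 1/2 in the total variation turns their sum into a single
  \<open>c\<close>.\<close>

lemma kappa_perturb:
  assumes "finite S" "S \<noteq> {}" "\<And>x. x \<in> S \<Longrightarrow> (\<Sum>y\<in>S. \<bar>A x y - B x y\<bar>) \<le> c"
  shows "kappa S A \<le> kappa S B + c"
proof (rule kappa_least[OF assms(2)])
  fix \<mu> \<nu> assume \<mu>: "\<mu> \<in> distributions S" and \<nu>: "\<nu> \<in> distributions S"
  define E where "E = (\<lambda>x y. A x y - B x y)"
  have split: "vec_mat S \<rho> A y = vec_mat S \<rho> B y + vec_mat S \<rho> E y" for \<rho> y
    unfolding vec_mat_def E_def by (simp add: sum.distrib[symmetric] algebra_simps)
  have "(\<Sum>y\<in>S. \<bar>vec_mat S \<mu> A y - vec_mat S \<nu> A y\<bar>)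
      \<le> (\<Sum>y\<in>S. \<bar>vec_mat S \<mu> B y - vec_mat S \<nu> B y\<bar> + \<bar>vec_mat S \<mu> E y\<bar> + \<bar>vec_mat S \<nu> E y\<bar>)"
    unfolding split by (intro sum_mono) linarith
  also have "\<dots> \<le> (\<Sum>y\<in>S. \<bar>vec_mat S \<mu> B y - vec_mat S \<nu> B y\<bar>) + c + c"
    unfolding sum.distrib
    by (intro add_mono order_refl sum_abs_vec_mat_le assms(1) \<mu> \<nu>) (auto simp: E_def assms(3))
  finally have "tv_dist S (vec_mat S \<mu> A) (vec_mat S \<nu> A)
      \<le> tv_dist S (vec_mat S \<mu> B) (vec_mat S \<nu> B) + c"
    by (simp add: tv_dist_def)
  also have "\<dots> \<le> kappa S B + c" using tv_le_kappa[OF assms(1) \<mu> \<nu>, of B] by simp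
  finally show "tv_dist S (vec_mat S \<mu> A) (vec_mat S \<nu> A) \<le> kappa S B + c" .
qed

subsection \<open>Confidence intervals for the skipped chains\<close>

lemma visits_cong: "(\<And>i. i \<in> {1..n} \<Longrightarrow> Y i = Y' i) \<Longrightarrow> visits n Y = visits n Y'"
  unfolding visits_def by (intro ext arg_cong[where f = card]) auto

lemma transitions_cong:
  "(\<And>i. i \<in> {1..n} \<Longrightarrow> Y i = Y' i) \<Longrightarrow> transitions n Y = transitions n Y'"
  unfolding transitions_def by (intro ext arg_cong[where f = card]) auto

lemma P_hat_cong:
  assumes "\<And>i. i \<in> {1..n} \<Longrightarrow> Y i = Y' i"
  shows "P_hat S lam n Y = P_hat S lam n Y'"
proof -
  have "visits n Y = visits n Y'" by (rule visits_cong) (rule assms)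
  moreover have "transitions n Y = transitions n Y'" by (rule transitions_cong) (rule assms)
  ultimately show ?thesis by (intro ext) (simp add: P_hat_def)
qed

lemma W_hat_cong:
  assumes "\<And>i. i \<in> {1..n} \<Longrightarrow> Y i = Y' i"
  shows "W_hat S lam d n Y = W_hat S lam d n Y'"
proof -
  have "visits n Y = visits n Y'" by (rule visits_cong) (rule assms)
  moreover have "transitions n Y = transitions n Y'" by (rule transitions_cong) (rule assms)
  ultimately show ?thesis by (simp add: W_hat_def)
qed

lemma kappa_P_hat_deviation:
  fixes l :: "'a list"
  assumes "finite S" "S \<noteq> {}" "row_stochastic S P" "\<And>x. x \<in> S \<Longrightarrow> 0 < lam x"
  defines "n \<equiv> length l" and "Y \<equiv> (\<lambda>i. l ! (i - 1))"
  assumes "\<And>x. x \<in> S \<Longrightarrow> tv_excess S (P x) (succs x l)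
      \<le> 3 / sqrt 2 * sqrt (real (length (succs x l))) * sqrt (ln (2 * real n * real (card S) / d))"
  shows "\<bar>kappa S (P_hat S lam n Y) - kappa S P\<bar> \<le> W_hat S lam d n Y"
proof -
  have row: "(\<Sum>y\<in>S. \<bar>P_hat S lam n Y x y - P x y\<bar>) \<le> W_hat S lam d n Y" if x: "x \<in> S" for x
  proof -
    define N where "N = real (visits n Y x)"
    define C where "C = (\<lambda>y. real (transitions n Y x y))"
    define a where "a = lam x"
    define k where "k = real (card S)"
    define t where "t = 3 / sqrt 2 * sqrt N * sqrt (ln (2 * real n * k / d))"
    define F where "F = (\<Sum>y\<in>S. sqrt (C y))"
    have N: "N = real (length (succs x l))"
      by (simp only: N_def n_def Y_def visits_eq_length_succs)
    have C: "C y = real (count_list (succs x l) y)" for y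
      by (simp only: C_def n_def Y_def transitions_eq_count_succs)
    have a: "0 < a" using assms(4)[OF x] by (simp add: a_def)
    have k: "0 < k" using assms(1,2) by (simp add: k_def card_gt_0_iff)
    have den: "0 < N + a * k" using a k by (simp add: N_def add_nonneg_pos)
    have excess: "(\<Sum>y\<in>S. \<bar>C y - N * P x y\<bar>) \<le> 2 * (F + t)"
      using assms(7)[OF x]
      by (simp add: tv_excess_def N[symmetric] C[symmetric] sum_subtractf sum_divide_distrib[symmetric]
          t_def F_def k_def)
    have Px: "0 \<le> P x y" if "y \<in> S" for y using row_stochastic_nonneg[OF assms(3) x that] .
    have "(\<Sum>y\<in>S. \<bar>P_hat S lam n Y x y - P x y\<bar>)
        \<le> (\<Sum>y\<in>S. (\<bar>C y - N * P x y\<bar> + (a + a * k * P x y)) / (N + a * k))"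
    proof (rule sum_mono)
      fix y assume y: "y \<in> S"
      \<comment> \<open>Separates the sampling error from the bias of smoothing. Summed over y the
        bias is at most 2 a k / (N + a k), so it joins the doubled sampling bound under the common
        factor 2 of \<open>W_hat\<close>.\<close>
      have "P_hat S lam n Y x y - P x y = ((C y - N * P x y) + (a - a * k * P x y)) / (N + a * k)"
        using den by (simp add: P_hat_def N_def[symmetric] C_def a_def[symmetric] k_def[symmetric] field_simps)
      moreover have "\<bar>(C y - N * P x y) + (a - a * k * P x y)\<bar>
          \<le> \<bar>C y - N * P x y\<bar> + (a + a * k * P x y)"
        using a k Px[OF y] by (smt (verit) mult_nonneg_nonneg)
      ultimately show "\<bar>P_hat S lam n Y x y - P x y\<bar>
          \<le> (\<bar>C y - N * P x y\<bar> + (a + a * k * P x y)) / (N + a * k)"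
        using den by (simp add: divide_right_mono)
    qed
    also have "\<dots> = ((\<Sum>y\<in>S. \<bar>C y - N * P x y\<bar>) + (a * k + a * k)) / (N + a * k)"
      by (simp add: sum_divide_distrib[symmetric] sum.distrib sum_distrib_left[symmetric]
          row_stochastic_sum[OF assms(3) x] k_def)
    also have "\<dots> \<le> (2 * (F + t) + (a * k + a * k)) / (N + a * k)"
      using excess den by (intro divide_right_mono add_mono) auto
    also have "\<dots> = 2 * ((F + t + a * k) / (N + a * k))" by (simp add: algebra_simps)
    also have "\<dots> \<le> W_hat S lam d n Y"
      unfolding W_hat_def F_def t_def N_def C_def a_def k_def
      using x assms(1) by (intro mult_left_mono Max_ge) auto
    finally show ?thesis .
  qed
  have "kappa S (P_hat S lam n Y) \<le> kappa S P + W_hat S lam d n Y"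
    by (rule kappa_perturb[OF assms(1,2)]) (rule row)
  moreover have "kappa S P \<le> kappa S (P_hat S lam n Y) + W_hat S lam d n Y"
    by (rule kappa_perturb[OF assms(1,2)]) (subst abs_minus_commute, rule row)
  ultimately show ?thesis by linarith
qed

text \<open>The exceptional event is produced explicitly, so that unions over many \<open>s\<close>
  and confidences can be formed. Defining it through the list of states makes it measurable.\<close>

lemma kappa_hat_confidence:
  assumes "finite S" "S \<noteq> {}" "row_stochastic S P" "\<mu> \<in> distributions S"
    and "\<And>x. x \<in> S \<Longrightarrow> 0 < lam x" "1 \<le> m" "prob_space M" "markov_trajectory M S \<mu> P m X"
    and "1 \<le> s" "0 < d" "d \<le> 1"
  obtains B where "B \<in> sets M" "measure M B \<le> d"
    "\<And>\<omega>. \<omega> \<in> space M - B \<Longrightarrow>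
       \<bar>kappa_hat S lam s m (\<lambda>t. X t \<omega>) - kappa S (mat_pow S P s)\<bar>
         \<le> W_hat_skip S lam d s m (\<lambda>t. X t \<omega>)"
proof -
  \<comment> \<open>q counts the complete blocks of s steps, so the skipped trajectory has q + 1
    states; r counts the steps after the last of them.\<close>
  define q r where "q = (m - 1) div s" and "r = (m - 1) mod s"
  have qr: "m - 1 = q * s + r" by (simp add: q_def r_def)
  define Q where "Q = (\<lambda>l. \<exists>x\<in>S. 3 / sqrt 2 * sqrt (real (length (succs x l)))
      * sqrt (ln (2 * real (Suc q) * real (card S) / d)) < tv_excess S (mat_pow S P s x) (succs x l))"
  define skip where "skip = (\<lambda>L :: 'a list. map (\<lambda>i. L ! (i * s)) [0..<Suc q])"
  define L where "L = (\<lambda>\<omega>. map (\<lambda>t. X t \<omega>) [1..<Suc m])"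
  define B where "B = {\<omega>\<in>space M. Q (skip (L \<omega>))}"
  have Ps: "row_stochastic S (mat_pow S P s)" by (rule row_stochastic_mat_pow[OF assms(1,3)])
  show ?thesis
  proof
    show "B \<in> sets M"
      unfolding B_def L_def by (rule markov_trajectory_path_exp[OF assms(1,7,8,6)])
    have "measure M B = (\<Sum>z\<in>S. pmf \<mu> z * path_exp S P (m - 1) z (\<lambda>ys. of_bool (Q (skip (z # ys)))))"
      unfolding B_def L_def by (rule markov_trajectory_path_exp[OF assms(1,7,8,6)])
    also have "\<dots> = (\<Sum>z\<in>S. pmf \<mu> z * path_exp S (mat_pow S P s) q z (\<lambda>zs. of_bool (Q (z # zs))))"
      unfolding qr skip_def
      by (intro sum.cong refl arg_cong[where f = "(*) _"]
          path_exp_skip[OF assms(1,3,9), where h = "\<lambda>l. of_bool (Q l)"])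
    also have "\<dots> \<le> (\<Sum>z\<in>S. pmf \<mu> z * (d / 2))"
    proof (intro sum_mono mult_left_mono)
      fix z assume "z \<in> S"
      from chain_tv_excess_tail[OF assms(1) Ps this _ assms(10,11), of "Suc q"]
      show "path_exp S (mat_pow S P s) q z (\<lambda>zs. of_bool (Q (z # zs))) \<le> d / 2"
        by (simp add: Q_def)
    qed auto
    also have "\<dots> = d / 2"
      by (simp add: sum_distrib_right[symmetric] pmf_sum_distributions[OF assms(1,4)] del: times_divide_eq_right)
    finally show "measure M B \<le> d" using assms(10) by simp
  next
    fix \<omega> assume \<omega>: "\<omega> \<in> space M - B"
    define l where "l = skip (L \<omega>)"
    have len: "skip_length s m = length l" by (simp add: skip_length_def l_def skip_def q_def)
    have Y: "skipped s (\<lambda>t. X t \<omega>) i = l ! (i - 1)" if ran: "i \<in> {1..length l}" for i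
    proof -
      have "i - 1 \<le> q" using that by (auto simp: l_def skip_def)
      then have "(i - 1) * s \<le> q * s" by (rule mult_le_mono1)
      also have "\<dots> \<le> m - 1" using qr by simp
      finally have "(i - 1) * s < m" using assms(6) by simp
      moreover obtain j where "i = Suc j" "j < Suc q"
        using ran len by (cases i) (auto simp: skip_length_def q_def)
      ultimately show ?thesis
        by (simp add: skipped_def l_def skip_def L_def nth_append del: upt_Suc)
    qed
    have P: "P_hat S lam (length l) (skipped s (\<lambda>t. X t \<omega>)) = P_hat S lam (length l) (\<lambda>i. l ! (i - 1))"
      by (rule P_hat_cong) (rule Y)
    have W: "W_hat S lam d (length l) (skipped s (\<lambda>t. X t \<omega>)) = W_hat S lam d (length l) (\<lambda>i. l ! (i - 1))"
      by (rule W_hat_cong) (rule Y)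
    have "tv_excess S (mat_pow S P s x) (succs x l) \<le> 3 / sqrt 2 * sqrt (real (length (succs x l)))
        * sqrt (ln (2 * real (length l) * real (card S) / d))" if "x \<in> S" for x
      using \<omega> that len by (force simp: B_def Q_def l_def[symmetric] skip_length_def q_def not_less)
    from kappa_P_hat_deviation[where lam = lam and l = l and d = d, OF assms(1,2) Ps assms(5) this]
    show "\<bar>kappa_hat S lam s m (\<lambda>t. X t \<omega>) - kappa S (mat_pow S P s)\<bar>
         \<le> W_hat_skip S lam d s m (\<lambda>t. X t \<omega>)"
      unfolding kappa_hat_def W_hat_skip_def len
      by (simp only: P W)
  qed
qed

section \<open>Size of the widths and range of the cutoff\<close>

lemma W_hat_ge:
  assumes "finite S" "S \<noteq> {}" "\<And>x. x \<in> S \<Longrightarrow> 0 < lam x" "1 \<le> n" "0 < d" "d \<le> 1/2"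
  shows "2 / sqrt (real n) \<le> W_hat S lam d n Y"
proof -
  from assms(2) obtain x where x: "x \<in> S" by blast
  define N where "N = real (visits n Y x)"
  define a where "a = lam x * real (card S)"
  define F where "F = (\<Sum>x'\<in>S. sqrt (real (transitions n Y x x')))"
  define u where "u = sqrt (ln (2 * real n * real (card S) / d))"
  have "0 < card S" using assms(1,2) by (simp add: card_gt_0_iff)
  then have card: "1 \<le> real (card S)" by simp
  have a: "0 < a" using assms(3)[OF x] card by (simp add: a_def)
  have N0: "0 \<le> N" by (simp add: N_def)
  have "{t. 1 \<le> t \<and> t < n \<and> Y t = x} \<subseteq> {1..<n}" by auto
  from card_mono[OF _ this] have Nn: "N \<le> real n" by (simp add: N_def visits_def)
  have "1 * 1 \<le> real n * real (card S)" using assms(4) card by (intro mult_mono) auto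
  \<comment> \<open>With d \<le> 1/2 the argument of the logarithm is at least 4 > e, so the
    logarithm is at least 1. In the application d is \<delta>/2.\<close>
  then have "4 * d \<le> 2 * real n * real (card S)" using assms(6) by simp
  then have "4 \<le> 2 * real n * real (card S) / d" using assms(5) by (simp add: field_simps)
  moreover have "exp 1 \<le> (4::real)" using exp_le by simp
  ultimately have "exp 1 \<le> 2 * real n * real (card S) / d" by linarith
  then have "1 \<le> ln (2 * real n * real (card S) / d)"
    by (smt (verit) exp_gt_zero ln_ge_iff)
  then have u: "1 \<le> u" by (simp add: u_def)
  have "1 \<le> 3 / sqrt (2::real)"
    using real_sqrt_le_mono[of 2 9] by simp
  then have "1 * sqrt N * 1 \<le> 3 / sqrt 2 * sqrt N * u"
    using u N0 by (intro mult_mono) auto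
  moreover have "0 \<le> F" unfolding F_def by (intro sum_nonneg) simp
  ultimately have num: "sqrt N + a \<le> F + 3 / sqrt 2 * sqrt N * u + a" by simp
  \<comment> \<open>The ratio (sqrt N + a)/(N + a) lies between 1/sqrt N and 1 for N \<ge> 1 and is
    1 for N = 0; since N \<le> n, it is at least 1/sqrt n in both cases.\<close>
  have "N + a \<le> (sqrt N + a) * sqrt (real n)"
  proof -
    have "sqrt N * sqrt N \<le> sqrt N * sqrt (real n)" using Nn N0 by (intro mult_left_mono) auto
    moreover have "a * 1 \<le> a * sqrt (real n)" using a assms(4) by (intro mult_left_mono) auto
    ultimately show ?thesis using N0 by (simp add: algebra_simps)
  qed
  then have "1 / sqrt (real n) \<le> (sqrt N + a) / (N + a)"
    using a N0 assms(4) by (simp add: field_simps)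
  also have "\<dots> \<le> (F + 3 / sqrt 2 * sqrt N * u + a) / (N + a)"
    using num a N0 by (intro divide_right_mono) auto
  finally have "2 * (1 / sqrt (real n)) \<le> 2 * ((F + 3 / sqrt 2 * sqrt N * u + a) / (N + a))"
    by (rule mult_left_mono) simp
  also have "\<dots> \<le> W_hat S lam d n Y"
    unfolding W_hat_def F_def N_def u_def a_def
    using x assms(1) by (intro mult_left_mono Max_ge) auto
  finally show ?thesis by simp
qed

text \<open>The term s = 1 alone keeps the maximum at or above 2/sqrt m; it belongs to the range
  because \<open>1 \<le> \<phi> m\<close>. The lower bound on the cutoff holds since the ceiling of
  a positive number is at least 1.\<close>

lemma S_hat_bounds:
  assumes "finite S" "S \<noteq> {}" "\<And>x. x \<in> S \<Longrightarrow> 0 < lam x" "1 \<le> m" "0 < d" "d \<le> 1/2" "1 \<le> \<phi> m"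
  shows "1 \<le> S_hat S \<phi> lam d m Y" and "S_hat S \<phi> lam d m Y \<le> nat \<lceil>sqrt (real m)\<rceil>"
proof -
  define W where "W = Max ((\<lambda>s. (1 / real s) * W_hat_skip S lam d s m Y) ` {1..\<phi> m})"
  have m: "skip_length 1 m = m" using assms(4) by (simp add: skip_length_def)
  have sq: "0 < sqrt (real m)" using assms(4) by simp
  have "2 / sqrt (real m) \<le> W_hat_skip S lam d 1 m Y"
    unfolding W_hat_skip_def m by (rule W_hat_ge) (use assms in auto)
  also have "\<dots> = 1 / real 1 * W_hat_skip S lam d 1 m Y" by simp
  also have "\<dots> \<le> W" unfolding W_def
    by (intro Max_ge finite_imageI finite_atLeastAtMost image_eqI[where x = 1]) (use assms(7) in simp_all)
  finally have W: "2 / sqrt (real m) \<le> W" .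
  then have W0: "0 < W" using sq by (smt (verit) divide_pos_pos)
  have "0 < 1 / W" using W0 by simp
  then show "1 \<le> S_hat S \<phi> lam d m Y" unfolding S_hat_def W_def[symmetric] by linarith
  have "1 / W \<le> sqrt (real m)"
    using W W0 sq by (simp add: field_simps)
  then show "S_hat S \<phi> lam d m Y \<le> nat \<lceil>sqrt (real m)\<rceil>"
    unfolding S_hat_def W_def[symmetric] by (intro nat_mono ceiling_mono)
qed

section \<open>Truncating the supremum in \<open>kappa_star\<close>\<close>

lemma kappa_star_term_le_1:
  assumes "finite S" "S \<noteq> {}" "1 \<le> s"
  shows "(1 - kappa S (mat_pow S P s)) / real s \<le> 1"
proof -
  have "(1 - kappa S (mat_pow S P s)) / real s \<le> 1 / real s"
    using kappa_nonneg[OF assms(1,2), of "mat_pow S P s"] by (intro divide_right_mono) auto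
  also have "\<dots> \<le> 1" using assms(3) by simp
  finally show ?thesis .
qed

lemma kappa_star_bdd_above:
  assumes "finite S" "S \<noteq> {}"
  shows "bdd_above ((\<lambda>s. (1 - kappa S (mat_pow S P s)) / real s) ` {1..})"
  by (rule bdd_aboveI2) (rule kappa_star_term_le_1[OF assms], simp)

lemma kappa_star_nonneg:
  assumes "finite S" "S \<noteq> {}"
  shows "0 \<le> kappa_star S P"
proof -
  have "(SUP s\<in>{1..}. (1 - kappa S (mat_pow S P s)) / real s) \<le> 1"
    by (rule cSUP_least) (simp, rule kappa_star_term_le_1[OF assms], simp)
  then show ?thesis by (simp add: kappa_star_def)
qed

text \<open>The first omitted index is \<sigma> + 1, so truncation costs at most 1/(\<sigma> + 1).
  That this is smaller than 1/\<sigma> is the source of the strict inequality, which the open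
  interval requires.\<close>

lemma kappa_star_deviation:
  assumes "finite S" "S \<noteq> {}" "row_stochastic S P" "1 \<le> \<sigma>"
    and "\<And>s. s \<in> {1..\<sigma>} \<Longrightarrow> \<bar>k s - kappa S (mat_pow S P s)\<bar> \<le> w s"
  shows "\<bar>(1 - Max ((\<lambda>s. (1 - k s) / real s) ` {1..\<sigma>})) - kappa_star S P\<bar>
         < 1 / real \<sigma> + Max ((\<lambda>s. (1 / real s) * w s) ` {1..\<sigma>})"
proof -
  define a where "a = (\<lambda>s. (1 - kappa S (mat_pow S P s)) / real s)"
  define m where "m = Max ((\<lambda>s. (1 - k s) / real s) ` {1..\<sigma>})"
  define v where "v = Max ((\<lambda>s. (1 / real s) * w s) ` {1..\<sigma>})"
  have bdd: "bdd_above (a ` {1..})" unfolding a_def by (rule kappa_star_bdd_above[OF assms(1,2)])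
  have a: "0 \<le> a s" "a s \<le> 1 / real s" for s
    using kappa_le_1[OF assms(1,2) row_stochastic_mat_pow[OF assms(1,3)], of s]
      kappa_nonneg[OF assms(1,2), of "mat_pow S P s"]
    by (auto simp: a_def divide_right_mono)
  have dev: "\<bar>(1 - k s) / real s - a s\<bar> \<le> v" if s: "s \<in> {1..\<sigma>}" for s
  proof -
    have "\<bar>(1 - k s) / real s - a s\<bar> = (1 / real s) * \<bar>k s - kappa S (mat_pow S P s)\<bar>"
      using s by (simp add: a_def diff_divide_distrib[symmetric] abs_minus_commute)
    also have "\<dots> \<le> (1 / real s) * w s" using assms(5)[OF s] by (intro mult_left_mono) auto
    also have "\<dots> \<le> v" unfolding v_def using s by (intro Max_ge) auto
    finally show ?thesis .
  qed
  have m_ge: "(1 - k s) / real s \<le> m" if "s \<in> {1..\<sigma>}" for s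
    unfolding m_def using that by (intro Max_ge) auto
  have ne: "(\<lambda>s. (1 - k s) / real s) ` {1..\<sigma>} \<noteq> {}" using assms(4) by simp
  have pos: "0 < 1 / real \<sigma>" using assms(4) by simp
  obtain s0 where s0: "s0 \<in> {1..\<sigma>}" "m = (1 - k s0) / real s0"
    using Max_in[OF _ ne] unfolding m_def by auto
  have "m \<le> a s0 + v" using dev[OF s0(1)] s0(2) by linarith
  also have "a s0 \<le> Sup (a ` {1..})" using s0(1) by (intro cSUP_upper[OF _ bdd]) auto
  finally have 1: "m \<le> Sup (a ` {1..}) + v" by simp
  have le: "a s \<le> m + v" if "s \<in> {1..\<sigma>}" for s using dev[OF that] m_ge[OF that] by linarith
  \<comment> \<open>An omitted term is bounded by 1/(\<sigma> + 1) alone, so comparing it with the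
    full right side requires m + v to be nonnegative; the term s = 1 shows this.\<close>
  have mv: "0 \<le> m + v" using le[of 1] a(1)[of 1] assms(4) by simp
  have "Sup (a ` {1..}) \<le> m + v + 1 / real (Suc \<sigma>)"
  proof (rule cSUP_least)
    fix s :: nat assume s: "s \<in> {1..}"
    show "a s \<le> m + v + 1 / real (Suc \<sigma>)"
    proof (cases "s \<le> \<sigma>")
      case True
      then show ?thesis using le[of s] s by (simp add: add_increasing2)
    next
      case False
      then have "1 / real s \<le> 1 / real (Suc \<sigma>)" by (intro divide_left_mono) auto
      then show ?thesis using a(2)[of s] mv by linarith
    qed
  qed simp
  also have "\<dots> < m + v + 1 / real \<sigma>" using assms(4) by (simp add: field_simps)
  finally have 2: "Sup (a ` {1..}) < m + v + 1 / real \<sigma>" .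
  show ?thesis
    unfolding kappa_star_def a_def[symmetric] m_def[symmetric] v_def[symmetric]
    using 1 2 pos by linarith
qed

subsection \<open>Ergodic chains\<close>

text \<open>As \<open>f\<close> has total mass 0, subtracting \<epsilon> from every entry does not
  change its image; the remaining matrix is nonnegative with row sums 1 - |S| \<epsilon>.\<close>

lemma doeblin_contraction:
  assumes "finite S" "row_stochastic S Q" "\<And>x y. x \<in> S \<Longrightarrow> y \<in> S \<Longrightarrow> \<epsilon> \<le> Q x y" "(\<Sum>x\<in>S. f x) = 0"
  shows "(\<Sum>y\<in>S. \<bar>\<Sum>x\<in>S. f x * Q x y\<bar>) \<le> (1 - real (card S) * \<epsilon>) * (\<Sum>x\<in>S. \<bar>f x\<bar>)"
proof -
  have "(\<Sum>x\<in>S. f x * Q x y) = (\<Sum>x\<in>S. f x * (Q x y - \<epsilon>))" for y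
    using assms(4) by (simp add: right_diff_distrib sum_subtractf sum_distrib_right[symmetric])
  then have "(\<Sum>y\<in>S. \<bar>\<Sum>x\<in>S. f x * Q x y\<bar>) \<le> (\<Sum>y\<in>S. \<Sum>x\<in>S. \<bar>f x\<bar> * (Q x y - \<epsilon>))"
    using assms(3) by (auto intro!: sum_mono order_trans[OF sum_abs] simp: abs_mult)
  also have "\<dots> = (\<Sum>x\<in>S. \<bar>f x\<bar> * (\<Sum>y\<in>S. Q x y - \<epsilon>))"
    by (subst sum.swap) (simp only: sum_distrib_left)
  also have "\<dots> = (\<Sum>x\<in>S. \<bar>f x\<bar> * (1 - real (card S) * \<epsilon>))"
    by (intro sum.cong) (auto simp: sum_subtractf row_stochastic_sum[OF assms(2)])
  finally show ?thesis by (simp add: sum_distrib_right[symmetric] mult.commute)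
qed

lemma ergodic_minorization:
  assumes "finite S" "S \<noteq> {}" "ergodic S P"
  obtains k \<epsilon> where "1 \<le> k" "0 < \<epsilon>" "\<And>x y. x \<in> S \<Longrightarrow> y \<in> S \<Longrightarrow> \<epsilon> \<le> mat_pow S P k x y"
    "0 \<le> 1 - real (card S) * \<epsilon>" "1 - real (card S) * \<epsilon> < 1"
proof -
  obtain k where k: "1 \<le> k" "\<forall>x\<in>S. \<forall>y\<in>S. 0 < mat_pow S P k x y"
    using assms(3) by (auto simp: ergodic_def primitive_def)
  define \<epsilon> where "\<epsilon> = Min ((\<lambda>(x, y). mat_pow S P k x y) ` (S \<times> S))"
  have fin: "finite ((\<lambda>(x, y). mat_pow S P k x y) ` (S \<times> S))" using assms(1) by simp
  have ne: "(\<lambda>(x, y). mat_pow S P k x y) ` (S \<times> S) \<noteq> {}" using assms(2) by simp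
  have \<epsilon>: "0 < \<epsilon>" unfolding \<epsilon>_def using k(2) by (subst Min_gr_iff[OF fin ne]) auto
  have le: "\<epsilon> \<le> mat_pow S P k x y" if "x \<in> S" "y \<in> S" for x y
    unfolding \<epsilon>_def using that by (intro Min_le fin) (auto intro!: image_eqI[of _ _ "(x, y)"])
  obtain x where x: "x \<in> S" using assms(2) by blast
  have "row_stochastic S (mat_pow S P k)"
    using assms(1,3) by (simp add: ergodic_def row_stochastic_mat_pow)
  then have "(\<Sum>y\<in>S. \<epsilon>) \<le> 1"
    using sum_mono[of S "\<lambda>_. \<epsilon>" "mat_pow S P k x"] le[OF x] row_stochastic_sum[of S _ x] x by fastforce
  moreover have "0 < real (card S) * \<epsilon>" using \<epsilon> assms(1,2) by (simp add: card_gt_0_iff)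
  ultimately show ?thesis using that[OF k(1) \<epsilon> le] by simp
qed

text \<open>One contracting power is enough, since the supremum dominates its term. The result keeps
  the denominators of the universal bounds positive.\<close>

lemma kappa_star_less_1:
  assumes "finite S" "S \<noteq> {}" "ergodic S P"
  shows "kappa_star S P < 1"
proof -
  obtain k \<epsilon> where k: "1 \<le> k" and \<epsilon>: "0 < \<epsilon>" "\<And>x y. x \<in> S \<Longrightarrow> y \<in> S \<Longrightarrow> \<epsilon> \<le> mat_pow S P k x y"
    and c: "0 \<le> 1 - real (card S) * \<epsilon>" "1 - real (card S) * \<epsilon> < 1"
    by (rule ergodic_minorization[OF assms]) blast
  let ?Q = "mat_pow S P k"
  have row: "row_stochastic S ?Q"
    using assms(1,3) by (simp add: ergodic_def row_stochastic_mat_pow)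
  have "kappa S ?Q \<le> 1 - real (card S) * \<epsilon>"
  proof (rule kappa_least[OF assms(2)])
    fix \<mu> \<nu> assume D: "\<mu> \<in> distributions S" "\<nu> \<in> distributions S"
    have eq: "vec_mat S \<mu> ?Q y - vec_mat S \<nu> ?Q y = (\<Sum>x\<in>S. (pmf \<mu> x - pmf \<nu> x) * ?Q x y)" for y
      by (simp add: vec_mat_def left_diff_distrib sum_subtractf)
    have "(\<Sum>x\<in>S. \<bar>pmf \<mu> x - pmf \<nu> x\<bar>) \<le> (\<Sum>x\<in>S. pmf \<mu> x + pmf \<nu> x)"
      by (intro sum_mono) (smt (verit) pmf_nonneg)
    also have "\<dots> = 2" by (simp add: sum.distrib pmf_sum_distributions[OF assms(1)] D)
    finally have le2: "(\<Sum>x\<in>S. \<bar>pmf \<mu> x - pmf \<nu> x\<bar>) \<le> 2" .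
    have "(\<Sum>y\<in>S. \<bar>vec_mat S \<mu> ?Q y - vec_mat S \<nu> ?Q y\<bar>)
        \<le> (1 - real (card S) * \<epsilon>) * (\<Sum>x\<in>S. \<bar>pmf \<mu> x - pmf \<nu> x\<bar>)"
      unfolding eq
      by (rule doeblin_contraction[OF assms(1) row \<epsilon>(2)])
         (simp_all add: sum_subtractf pmf_sum_distributions[OF assms(1)] D)
    also have "\<dots> \<le> (1 - real (card S) * \<epsilon>) * 2" by (rule mult_left_mono[OF le2 c(1)])
    finally show "tv_dist S (vec_mat S \<mu> ?Q) (vec_mat S \<nu> ?Q) \<le> 1 - real (card S) * \<epsilon>"
      by (simp add: tv_dist_def)
  qed
  then have "0 < (1 - kappa S ?Q) / real k" using c k by simp
  also have "\<dots> \<le> (SUP s\<in>{1..}. (1 - kappa S (mat_pow S P s)) / real s)"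
    using k by (intro cSUP_upper kappa_star_bdd_above assms) auto
  finally show ?thesis by (simp add: kappa_star_def)
qed

text \<open>The definition of \<open>t_mix\<close> through \<open>THE\<close> makes the invariance of the mixing time under
  relabelling depend on this.\<close>

lemma ergodic_stationary_ex1:
  assumes "finite S" "S \<noteq> {}" "ergodic S P"
  shows "\<exists>!\<pi>. \<pi> \<in> distributions S \<and> (\<forall>y\<in>S. vec_mat S \<pi> P y = pmf \<pi> y)"
proof -
  obtain k \<epsilon> where k: "1 \<le> k" and \<epsilon>: "0 < \<epsilon>" "\<And>x y. x \<in> S \<Longrightarrow> y \<in> S \<Longrightarrow> \<epsilon> \<le> mat_pow S P k x y"
    and c: "0 \<le> 1 - real (card S) * \<epsilon>" "1 - real (card S) * \<epsilon> < 1"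
    by (rule ergodic_minorization[OF assms]) blast
  define c where "c = 1 - real (card S) * \<epsilon>"
  define Q where "Q = mat_pow S P k"
  have P: "row_stochastic S P" using assms(3) by (simp add: ergodic_def)
  have row: "row_stochastic S Q" unfolding Q_def by (rule row_stochastic_mat_pow[OF assms(1) P])
  have contr: "(\<Sum>y\<in>S. \<bar>\<Sum>x\<in>S. f x * Q x y\<bar>) \<le> c * (\<Sum>x\<in>S. \<bar>f x\<bar>)" if "(\<Sum>x\<in>S. f x) = 0" for f
    unfolding c_def Q_def
    by (rule doeblin_contraction[OF assms(1) row[unfolded Q_def] \<epsilon>(2) that])
  \<comment> \<open>The difference of two \<open>Q\<close>-invariant vectors of equal mass has mass
    0 and is its own image, so the contraction forces it to vanish. Real vectors are allowed because
    it is applied below to the image of \<open>w\<close> under \<open>P\<close>, before any pmf is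
    available.\<close>
  have fixed_unique: "f y = g y"
    if "\<And>y. y \<in> S \<Longrightarrow> (\<Sum>x\<in>S. f x * Q x y) = f y" "\<And>y. y \<in> S \<Longrightarrow> (\<Sum>x\<in>S. g x * Q x y) = g y"
      "(\<Sum>x\<in>S. f x) = (\<Sum>x\<in>S. g x)" "y \<in> S" for f g :: "'a \<Rightarrow> real" and y
  proof -
    define h where "h = (\<lambda>x. f x - g x)"
    have "(\<Sum>y\<in>S. \<bar>h y\<bar>) = (\<Sum>y\<in>S. \<bar>\<Sum>x\<in>S. h x * Q x y\<bar>)"
      using that(1,2) by (intro sum.cong) (auto simp: h_def left_diff_distrib sum_subtractf)
    also have "\<dots> \<le> c * (\<Sum>x\<in>S. \<bar>h x\<bar>)"
      by (rule contr) (simp add: h_def sum_subtractf that(3))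
    finally have "(1 - c) * (\<Sum>y\<in>S. \<bar>h y\<bar>) \<le> 0" by (simp add: algebra_simps)
    moreover have "0 < 1 - c" using c by (simp add: c_def)
    ultimately have "(\<Sum>y\<in>S. \<bar>h y\<bar>) \<le> 0" by (simp add: mult_le_0_iff)
    then have "(\<Sum>y\<in>S. \<bar>h y\<bar>) = 0" by (intro antisym sum_nonneg) auto
    then show "f y = g y" using that(4) assms(1) by (simp add: sum_nonneg_eq_0_iff h_def)
  qed
  have stat_Q: "(\<Sum>x\<in>S. f x * mat_pow S P n x y) = f y"
    if f: "\<And>y. y \<in> S \<Longrightarrow> (\<Sum>x\<in>S. f x * P x y) = f y" and "y \<in> S" for f :: "'a \<Rightarrow> real" and y n
    using \<open>y \<in> S\<close>
  proof (induction n arbitrary: y)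
    case 0
    then show ?case
      using assms(1) by (simp add: if_distrib[of "\<lambda>u. _ * u"] cong: if_cong)
  next
    case (Suc n)
    have "(\<Sum>x\<in>S. f x * mat_pow S P (Suc n) x y) = (\<Sum>z\<in>S. (\<Sum>x\<in>S. f x * mat_pow S P n x z) * P z y)"
      by (simp add: sum_distrib_left sum_distrib_right mult.assoc) (rule sum.swap)
    also have "\<dots> = (\<Sum>z\<in>S. f z * P z y)" by (intro sum.cong) (simp_all add: Suc.IH)
    finally show ?case using f[OF Suc.prems] by simp
  qed
  obtain x0 where x0: "x0 \<in> S" using assms(2) by blast
  \<comment> \<open>The candidate is the limit of the law of the chain started in x0, observed at
    multiples of k. Successive differences have mass 0 and shrink geometrically.\<close>
  define v where "v = (\<lambda>q y. mat_pow S P (q * k) x0 y)"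
  have v_Suc: "v (Suc q) y = (\<Sum>x\<in>S. v q x * Q x y)" if "y \<in> S" for q y
    using mat_pow_add[OF assms(1) that, of P "q * k" k x0] by (simp add: v_def Q_def add.commute)
  have v_row: "0 \<le> v q y" "(\<Sum>y\<in>S. v q y) = 1" if "y \<in> S" for q y
    using row_stochastic_mat_pow[OF assms(1) P, of "q * k"] x0 that
    by (auto simp: v_def row_stochastic_def)
  have v_sum: "(\<Sum>y\<in>S. v q y) = 1" for q using v_row(2)[OF x0] .
  have v_step: "(\<Sum>y\<in>S. \<bar>v (Suc q) y - v q y\<bar>) \<le> c ^ q * (\<Sum>y\<in>S. \<bar>v 1 y - v 0 y\<bar>)" for q
  proof (induction q)
    case (Suc q)
    have "(\<Sum>y\<in>S. \<bar>v (Suc (Suc q)) y - v (Suc q) y\<bar>)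
        = (\<Sum>y\<in>S. \<bar>\<Sum>x\<in>S. (v (Suc q) x - v q x) * Q x y\<bar>)"
      by (intro sum.cong) (simp_all add: v_Suc[of _ "Suc q"] v_Suc[of _ q] left_diff_distrib sum_subtractf)
    also have "\<dots> \<le> c * (\<Sum>x\<in>S. \<bar>v (Suc q) x - v q x\<bar>)"
      by (rule contr) (simp add: sum_subtractf v_sum)
    also have "\<dots> \<le> c * (c ^ q * (\<Sum>y\<in>S. \<bar>v 1 y - v 0 y\<bar>))"
      using Suc.IH c(1) by (intro mult_left_mono) (auto simp: c_def)
    finally show ?case by simp
  qed simp
  have "convergent (\<lambda>q. v q y)" if y: "y \<in> S" for y
  proof -
    have "summable (\<lambda>q. v (Suc q) y - v q y)"
    proof (rule summable_comparison_test)
      show "\<exists>N. \<forall>q\<ge>N. norm (v (Suc q) y - v q y) \<le> c ^ q * (\<Sum>y\<in>S. \<bar>v 1 y - v 0 y\<bar>)"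
      proof (intro exI allI impI)
        fix q
        have "\<bar>v (Suc q) y - v q y\<bar> \<le> (\<Sum>y\<in>S. \<bar>v (Suc q) y - v q y\<bar>)"
          using member_le_sum[OF y, of "\<lambda>y. \<bar>v (Suc q) y - v q y\<bar>"] assms(1) by simp
        then show "norm (v (Suc q) y - v q y) \<le> c ^ q * (\<Sum>y\<in>S. \<bar>v 1 y - v 0 y\<bar>)"
          using v_step[of q] by simp
      qed
      show "summable (\<lambda>q. c ^ q * (\<Sum>y\<in>S. \<bar>v 1 y - v 0 y\<bar>))"
        using c by (intro summable_mult2 summable_geometric) (simp add: c_def)
    qed
    from summable_LIMSEQ[OF this]
    have "(\<lambda>q. v q y - v 0 y) \<longlonglongrightarrow> (\<Sum>q. v (Suc q) y - v q y)"
      by (simp only: sum_lessThan_telescope[of "\<lambda>q. v q y"])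
    from tendsto_add[OF this tendsto_const[of "v 0 y"]] show ?thesis
      by (auto simp: convergent_def)
  qed
  then obtain w where w: "\<And>y. y \<in> S \<Longrightarrow> (\<lambda>q. v q y) \<longlonglongrightarrow> w y"
    unfolding convergent_def by metis
  have w_nonneg: "0 \<le> w y" if "y \<in> S" for y
    using v_row(1)[OF that] by (intro LIMSEQ_le_const[OF w[OF that]]) auto
  have "(\<lambda>q. \<Sum>y\<in>S. v q y) \<longlonglongrightarrow> (\<Sum>y\<in>S. w y)" by (intro tendsto_sum w)
  then have w_sum: "(\<Sum>y\<in>S. w y) = 1" by (simp add: v_sum LIMSEQ_const_iff)
  have w_Q: "(\<Sum>x\<in>S. w x * Q x y) = w y" if "y \<in> S" for y
  proof (rule LIMSEQ_unique)
    show "(\<lambda>q. v (Suc q) y) \<longlonglongrightarrow> (\<Sum>x\<in>S. w x * Q x y)"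
      unfolding v_Suc[OF that] by (intro tendsto_sum tendsto_mult_right w)
    show "(\<lambda>q. v (Suc q) y) \<longlonglongrightarrow> w y"
      by (rule LIMSEQ_Suc[OF w[OF that]])
  qed
  \<comment> \<open>So far \<open>w\<close> is invariant under the power \<open>Q\<close> only. As
    \<open>P\<close> commutes with \<open>Q\<close>, the image of \<open>w\<close> under
    \<open>P\<close> is again \<open>Q\<close>-invariant with the same mass, hence equal to
    \<open>w\<close>.\<close>
  have w_P: "(\<Sum>x\<in>S. w x * P x y) = w y" if "y \<in> S" for y
  proof (rule fixed_unique[OF _ w_Q _ that])
    fix y assume y: "y \<in> S"
    have comm: "(\<Sum>x\<in>S. P z x * Q x y) = (\<Sum>x\<in>S. Q z x * P x y)" if "z \<in> S" for z
      using mat_pow_Suc_left[OF assms(1) that y, of P k] by (simp add: Q_def)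
    have "(\<Sum>x\<in>S. (\<Sum>z\<in>S. w z * P z x) * Q x y) = (\<Sum>z\<in>S. w z * (\<Sum>x\<in>S. P z x * Q x y))"
      by (simp add: sum_distrib_left sum_distrib_right mult.assoc) (rule sum.swap)
    also have "\<dots> = (\<Sum>z\<in>S. w z * (\<Sum>x\<in>S. Q z x * P x y))"
      by (intro sum.cong refl arg_cong[where f = "(*) _"] comm)
    also have "\<dots> = (\<Sum>x\<in>S. (\<Sum>z\<in>S. w z * Q z x) * P x y)"
      by (simp add: sum_distrib_left sum_distrib_right mult.assoc) (rule sum.swap)
    also have "\<dots> = (\<Sum>x\<in>S. w x * P x y)" by (intro sum.cong) (simp_all add: w_Q)
    finally show "(\<Sum>x\<in>S. (\<Sum>z\<in>S. w z * P z x) * Q x y) = (\<Sum>x\<in>S. w x * P x y)" .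
  next
    have "(\<Sum>x\<in>S. \<Sum>z\<in>S. w z * P z x) = (\<Sum>z\<in>S. w z * (\<Sum>x\<in>S. P z x))"
      by (subst sum.swap) (simp only: sum_distrib_left)
    also have "\<dots> = (\<Sum>z\<in>S. w z)"
      by (intro sum.cong) (simp_all add: row_stochastic_sum[OF P])
    finally show "(\<Sum>x\<in>S. \<Sum>z\<in>S. w z * P z x) = (\<Sum>x\<in>S. w x)" .
  qed
  obtain \<pi> where \<pi>: "\<pi> \<in> distributions S" "\<And>y. y \<in> S \<Longrightarrow> pmf \<pi> y = w y"
    using row_pmf_exists[OF assms(1) w_nonneg w_sum] by metis
  show ?thesis
  proof (rule ex1I[of _ \<pi>])
    have "vec_mat S \<pi> P y = (\<Sum>x\<in>S. w x * P x y)" for y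
      unfolding vec_mat_def by (intro sum.cong) (simp_all add: \<pi>(2))
    then show "\<pi> \<in> distributions S \<and> (\<forall>y\<in>S. vec_mat S \<pi> P y = pmf \<pi> y)"
      using \<pi> w_P by simp
  next
    fix \<rho> assume \<rho>: "\<rho> \<in> distributions S \<and> (\<forall>y\<in>S. vec_mat S \<rho> P y = pmf \<rho> y)"
    have "pmf \<rho> y = w y" if "y \<in> S" for y
    proof (rule fixed_unique[OF _ w_Q _ that])
      show "(\<Sum>x\<in>S. pmf \<rho> x * Q x y) = pmf \<rho> y" if "y \<in> S" for y
        unfolding Q_def using \<rho> that by (intro stat_Q) (auto simp: vec_mat_def)
      show "(\<Sum>x\<in>S. pmf \<rho> x) = (\<Sum>x\<in>S. w x)"
        using \<rho> by (simp add: pmf_sum_distributions[OF assms(1)] w_sum)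
    qed
    moreover have "pmf q y = 0" if "q \<in> distributions S" "y \<notin> S" for q y
      using that by (auto simp: distributions_def set_pmf_iff)
    ultimately have "pmf \<rho> y = pmf \<pi> y" for y
      using \<rho> \<pi> by (cases "y \<in> S") simp_all
    then show "\<rho> = \<pi>" by (simp add: pmf_eqI)
  qed
qed

subsection \<open>Relabelling the state space\<close>

context
  fixes S :: "'a set" and T :: "'b set" and f :: "'a \<Rightarrow> 'b"
  assumes bij: "bij_betw f S T" and fin: "finite S"
begin

text \<open>\<open>f\<close> is injective on \<open>S\<close> only, so for a point outside the
  support it must be excluded that another point carrying mass is sent to
  \<open>f x\<close>.\<close>

lemma pmf_map_relabel:
  assumes "\<mu> \<in> distributions S" "x \<in> S"
  shows "pmf (map_pmf f \<mu>) (f x) = pmf \<mu> x"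
proof (cases "x \<in> set_pmf \<mu>")
  case True
  then show ?thesis
    using assms(1) bij
    by (intro pmf_map_inj) (auto simp: distributions_def bij_betw_def intro: inj_on_subset)
next
  case False
  then have "f x \<notin> f ` set_pmf \<mu>"
    using assms bij by (auto simp: distributions_def bij_betw_def inj_on_def)
  then show ?thesis using False by (metis pmf_eq_0_set_pmf set_map_pmf)
qed

lemma distributions_relabel: "distributions T = map_pmf f ` distributions S"
proof (intro equalityI subsetI)
  fix \<nu> assume \<nu>: "\<nu> \<in> distributions T"
  have T: "T = f ` S" using bij by (simp add: bij_betw_def)
  have "map_pmf f (map_pmf (inv_into S f) \<nu>) = map_pmf id \<nu>"
    unfolding map_pmf_comp using \<nu> T
    by (intro map_pmf_cong) (auto simp: distributions_def f_inv_into_f)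
  moreover have "map_pmf (inv_into S f) \<nu> \<in> distributions S"
    using \<nu> T by (auto simp: distributions_def intro!: inv_into_into)
  ultimately show "\<nu> \<in> map_pmf f ` distributions S" by (metis image_eqI map_pmf_id id_apply)
next
  fix \<nu> assume "\<nu> \<in> map_pmf f ` distributions S"
  then show "\<nu> \<in> distributions T"
    using bij by (fastforce simp: distributions_def bij_betw_def)
qed

lemma vec_mat_relabel:
  assumes "\<mu> \<in> distributions S" "y \<in> S" "\<And>x y. x \<in> S \<Longrightarrow> y \<in> S \<Longrightarrow> Q' (f x) (f y) = Q x y"
  shows "vec_mat T (map_pmf f \<mu>) Q' (f y) = vec_mat S \<mu> Q y"
  unfolding vec_mat_def
  by (subst sum.reindex_bij_betw[OF bij, symmetric], intro sum.cong)
     (auto simp: assms pmf_map_relabel)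

lemma tv_dist_relabel:
  assumes "\<And>x. x \<in> S \<Longrightarrow> g' (f x) = g x" "\<And>x. x \<in> S \<Longrightarrow> h' (f x) = h x"
  shows "tv_dist T g' h' = tv_dist S g h"
  unfolding tv_dist_def
  by (subst sum.reindex_bij_betw[OF bij, symmetric]) (simp add: assms)

lemma kappa_relabel:
  assumes "\<And>x y. x \<in> S \<Longrightarrow> y \<in> S \<Longrightarrow> Q' (f x) (f y) = Q x y"
  shows "kappa T Q' = kappa S Q"
proof -
  have "distributions T \<times> distributions T
      = map_prod (map_pmf f) (map_pmf f) ` (distributions S \<times> distributions S)"
    unfolding distributions_relabel by auto
  then have "(\<lambda>(\<mu>, \<nu>). tv_dist T (vec_mat T \<mu> Q') (vec_mat T \<nu> Q')) ` (distributions T \<times> distributions T)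
      = (\<lambda>(\<mu>, \<nu>). tv_dist S (vec_mat S \<mu> Q) (vec_mat S \<nu> Q)) ` (distributions S \<times> distributions S)"
    by (simp only: image_image, intro image_cong refl)
       (auto intro!: tv_dist_relabel vec_mat_relabel assms)
  then show ?thesis by (simp only: kappa_def)
qed

context
  fixes P :: "'a \<Rightarrow> 'a \<Rightarrow> real" and P' :: "'b \<Rightarrow> 'b \<Rightarrow> real"
  assumes P': "\<And>x y. x \<in> S \<Longrightarrow> y \<in> S \<Longrightarrow> P' (f x) (f y) = P x y"
begin

lemma mat_pow_relabel:
  assumes "x \<in> S" "y \<in> S"
  shows "mat_pow T P' n (f x) (f y) = mat_pow S P n x y"
  using assms(2)
proof (induction n arbitrary: y)
  case 0
  then show ?case using assms(1) bij by (auto simp: bij_betw_def inj_on_def)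
next
  case (Suc n)
  show ?case
    unfolding mat_pow.simps
    by (subst sum.reindex_bij_betw[OF bij, symmetric], intro sum.cong)
       (simp_all add: Suc.IH P' Suc.prems)
qed

lemma ergodic_relabel:
  assumes "ergodic S P"
  shows "ergodic T P'"
proof -
  have T: "T = f ` S" using bij by (simp add: bij_betw_def)
  have "row_stochastic T P'"
    unfolding row_stochastic_def
    by (subst sum.reindex_bij_betw[OF bij, symmetric])
       (use assms in \<open>auto simp: ergodic_def row_stochastic_def T P'\<close>)
  moreover have "primitive T P'"
    using assms by (auto simp: ergodic_def primitive_def T mat_pow_relabel[unfolded T])
  ultimately show ?thesis by (simp add: ergodic_def)
qed

lemma kappa_star_relabel: "kappa_star T P' = kappa_star S P"
proof -
  have "kappa T (mat_pow T P' s) = kappa S (mat_pow S P s)" for s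
    by (rule kappa_relabel) (rule mat_pow_relabel)
  then show ?thesis by (simp add: kappa_star_def)
qed

text \<open>The image distribution is stationary for \<open>P'\<close>, and uniqueness over
  \<open>T\<close> identifies it with the value of the description there.\<close>

lemma stationary_dist_relabel:
  assumes "S \<noteq> {}" "ergodic S P"
  shows "stationary_dist S P \<in> distributions S"
    and "stationary_dist T P' = map_pmf f (stationary_dist S P)"
proof -
  let ?\<pi> = "stationary_dist S P"
  have \<pi>: "?\<pi> \<in> distributions S \<and> (\<forall>y\<in>S. vec_mat S ?\<pi> P y = pmf ?\<pi> y)"
    unfolding stationary_dist_def by (rule theI'[OF ergodic_stationary_ex1[OF fin assms]])
  then show "?\<pi> \<in> distributions S" by simp
  have T: "T = f ` S" using bij by (simp add: bij_betw_def)
  have "finite T" "T \<noteq> {}" using fin assms(1) T by auto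
  then have "\<exists>!\<pi>. \<pi> \<in> distributions T \<and> (\<forall>y\<in>T. vec_mat T \<pi> P' y = pmf \<pi> y)"
    by (rule ergodic_stationary_ex1) (rule ergodic_relabel[OF assms(2)])
  then show "stationary_dist T P' = map_pmf f ?\<pi>"
    unfolding stationary_dist_def[of T]
  proof (rule the1_equality)
    have "vec_mat T (map_pmf f ?\<pi>) P' (f y) = pmf (map_pmf f ?\<pi>) (f y)" if "y \<in> S" for y
      using \<pi> that vec_mat_relabel[of ?\<pi> y P' P] P' by (simp add: pmf_map_relabel)
    then show "map_pmf f ?\<pi> \<in> distributions T
        \<and> (\<forall>y\<in>T. vec_mat T (map_pmf f ?\<pi>) P' y = pmf (map_pmf f ?\<pi>) y)"
      using \<pi> by (simp add: distributions_relabel) (simp add: T)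
  qed
qed

lemma t_mix_relabel:
  assumes "S \<noteq> {}" "ergodic S P"
  shows "t_mix T P' = t_mix S P"
proof -
  have "(SUP \<mu>\<in>distributions T. tv_dist T (vec_mat T \<mu> (mat_pow T P' t)) (pmf (stationary_dist T P')))
      = (SUP \<mu>\<in>distributions S. tv_dist S (vec_mat S \<mu> (mat_pow S P t)) (pmf (stationary_dist S P)))" for t
    unfolding distributions_relabel image_image stationary_dist_relabel(2)[OF assms]
    by (intro arg_cong[where f = Sup] image_cong refl tv_dist_relabel vec_mat_relabel
        mat_pow_relabel pmf_map_relabel stationary_dist_relabel(1)[OF assms])
  then show ?thesis by (simp only: t_mix_def)
qed

end

end

lemma universal_constantsD:
  fixes S :: "'a set"
  assumes "universal_constants c_lo c_hi" "finite S" "S \<noteq> {}" "ergodic S P"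
  shows "c_lo / (1 - kappa_star S P) \<le> real (t_mix S P)"
    and "real (t_mix S P) \<le> c_hi / (1 - kappa_star S P)"
proof -
  obtain f :: "'a \<Rightarrow> nat" where "bij_betw f S {0..<card S}"
    using ex_bij_betw_finite_nat[OF assms(2)] by blast
  then have bij: "bij_betw f S (f ` S)" by (simp add: bij_betw_def)
  define P' where "P' = (\<lambda>i j. P (inv_into S f i) (inv_into S f j))"
  have P': "P' (f x) (f y) = P x y" if "x \<in> S" "y \<in> S" for x y
    using that bij by (simp add: P'_def bij_betw_inv_into_left)
  have "ergodic (f ` S) P'" by (rule ergodic_relabel[OF bij assms(2) P' assms(4)])
  then have "c_lo / (1 - kappa_star (f ` S) P') \<le> real (t_mix (f ` S) P')
      \<and> real (t_mix (f ` S) P') \<le> c_hi / (1 - kappa_star (f ` S) P')"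
    using assms(1-3) unfolding universal_constants_def by blast
  then show "c_lo / (1 - kappa_star S P) \<le> real (t_mix S P)"
    and "real (t_mix S P) \<le> c_hi / (1 - kappa_star S P)"
    by (simp_all add: kappa_star_relabel[where P = P, OF bij assms(2) P']
        t_mix_relabel[where P = P, OF bij assms(2) P' assms(3,4)])
qed

text \<open>A chain with \<open>\<kappa>\<^sub>\<star> > 0\<close> that mixes in one step; it keeps the lower end of the interval
  strictly below \<open>t\<^sub>m\<^sub>i\<^sub>x\<close> when \<open>\<kappa>\<^sub>\<star> = 0\<close>.\<close>

lemma universal_constants_lo_less_1:
  assumes "universal_constants c_lo c_hi"
  shows "c_lo < 1"
proof -
  define S :: "nat set" where "S = {0, 1}"
  \<comment> \<open>The second eigenvalue is 5/8 - 3/8 = 1/4: one step brings every start within 1/8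
    of uniform, yet the contraction coefficient 1/4 at s = 1 and the bound 1/s for s \<ge> 2 keep 1
    - kappa_star at most 3/4. Hence c_lo \<le> 3/4.\<close>
  define P :: "nat \<Rightarrow> nat \<Rightarrow> real" where "P = (\<lambda>i j. if i = j then 5/8 else 3/8)"
  have fin: "finite S" and ne: "S \<noteq> {}" by (auto simp: S_def)
  have row: "row_stochastic S P" by (auto simp: row_stochastic_def S_def P_def)
  have pow1: "mat_pow S P 1 x y = P x y" if "x \<in> S" for x y
    by (rule mat_pow_1[OF fin that])
  have erg: "ergodic S P"
    unfolding ergodic_def primitive_def
    by (intro conjI row exI[of _ 1] ballI) (simp_all only: pow1, auto simp: P_def)
  define \<pi> where "\<pi> = pmf_of_set S"
  have pmf_\<pi>: "pmf \<pi> y = 1/2" if "y \<in> S" for y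
    using that unfolding \<pi>_def by (subst pmf_of_set[OF ne fin]) (auto simp: S_def)
  have \<pi>: "stationary_dist S P = \<pi>"
    unfolding stationary_dist_def
  proof (rule the1_equality[OF ergodic_stationary_ex1[OF fin ne erg]], intro conjI ballI)
    show "\<pi> \<in> distributions S" unfolding \<pi>_def distributions_def using set_pmf_of_set[OF ne fin] by simp
    show "vec_mat S \<pi> P y = pmf \<pi> y" if "y \<in> S" for y
    proof -
      have "vec_mat S \<pi> P y = (\<Sum>x\<in>S. 1/2 * P x y)"
        unfolding vec_mat_def by (intro sum.cong) (simp_all add: pmf_\<pi>)
      then show ?thesis using that pmf_\<pi>[OF that] by (auto simp: S_def P_def)
    qed
  qed
  have vm: "vec_mat S \<mu> (mat_pow S P 1) y = 3/8 + pmf \<mu> y / 4"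
    if "\<mu> \<in> distributions S" "y \<in> S" for \<mu> y
  proof -
    have "pmf \<mu> 0 + pmf \<mu> 1 = 1" using pmf_sum_distributions[OF fin that(1)] by (simp add: S_def)
    moreover have "vec_mat S \<mu> (mat_pow S P 1) y = (\<Sum>x\<in>S. pmf \<mu> x * P x y)"
      unfolding vec_mat_def by (intro sum.cong refl) (simp only: pow1)
    ultimately show ?thesis using that(2) by (auto simp: S_def P_def)
  qed
  have "tv_dist S (vec_mat S \<mu> (mat_pow S P 1)) (pmf \<pi>) \<le> 1/8" if "\<mu> \<in> distributions S" for \<mu>
  proof -
    have "\<bar>vec_mat S \<mu> (mat_pow S P 1) y - pmf \<pi> y\<bar> \<le> 1/8" if "y \<in> S" for y
      using vm[OF \<open>\<mu> \<in> distributions S\<close> that] pmf_\<pi>[OF that] pmf_nonneg[of \<mu> y] pmf_le_1[of \<mu> y]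
      unfolding abs_le_iff by (simp only:) linarith
    then have "(\<Sum>y\<in>S. \<bar>vec_mat S \<mu> (mat_pow S P 1) y - pmf \<pi> y\<bar>) \<le> (\<Sum>y\<in>S. 1/8)"
      by (rule sum_mono)
    then show ?thesis by (simp add: tv_dist_def S_def)
  qed
  then have "(SUP \<mu>\<in>distributions S. tv_dist S (vec_mat S \<mu> (mat_pow S P 1)) (pmf (stationary_dist S P))) \<le> 1/8"
    unfolding \<pi> using distributions_nonempty[OF ne] by (intro cSUP_least) auto
  then have "t_mix S P \<le> 1"
    unfolding t_mix_def by (intro Least_le) simp
  have "tv_dist S (vec_mat S (return_pmf 0) (mat_pow S P 1)) (vec_mat S (return_pmf 1) (mat_pow S P 1))
      \<le> kappa S (mat_pow S P 1)"
    by (rule tv_le_kappa[OF fin]) (auto simp: distributions_def S_def)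
  moreover have "tv_dist S (vec_mat S (return_pmf 0) (mat_pow S P 1)) (vec_mat S (return_pmf 1) (mat_pow S P 1))
      = tv_dist S (\<lambda>y. 3/8 + pmf (return_pmf 0) y / 4) (\<lambda>y. 3/8 + pmf (return_pmf 1) y / 4)"
    unfolding tv_dist_def
    by (intro arg_cong[where f = "(*) _"] sum.cong refl arg_cong[where f = abs] arg_cong2[where f = minus] vm)
       (auto simp: distributions_def S_def)
  ultimately have kappa1: "1/4 \<le> kappa S (mat_pow S P 1)"
    by (simp add: tv_dist_def S_def)
  have "(SUP s\<in>{1..}. (1 - kappa S (mat_pow S P s)) / real s) \<le> 3/4"
  proof (rule cSUP_least)
    fix s :: nat assume s: "s \<in> {1..}"
    show "(1 - kappa S (mat_pow S P s)) / real s \<le> 3/4"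
    proof (cases "s = 1")
      case True
      then show ?thesis using kappa1 by (simp del: mat_pow.simps One_nat_def)
    next
      case False
      have "(1 - kappa S (mat_pow S P s)) / real s \<le> 1 / real s"
        using kappa_nonneg[OF fin ne, of "mat_pow S P s"] by (intro divide_right_mono) auto
      also have "\<dots> \<le> 1 / 2" using s False by (intro divide_left_mono) auto
      also have "\<dots> \<le> 3 / 4" by simp
      finally show ?thesis .
    qed
  qed simp
  then have "1 - kappa_star S P \<le> 3/4" by (simp add: kappa_star_def)
  moreover have "0 < 1 - kappa_star S P" using kappa_star_less_1[OF fin ne erg] by simp
  moreover have "c_lo / (1 - kappa_star S P) \<le> 1"
    using universal_constantsD(1)[OF assms fin ne erg] \<open>t_mix S P \<le> 1\<close> by simp
  ultimately show ?thesis by (simp add: field_simps)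
qed

subsection \<open>The confidence interval for the mixing time\<close>

lemma skipped_cong:
  assumes "1 \<le> m" "\<And>t. t \<in> {1..m} \<Longrightarrow> Y t = Y' t" "i \<in> {1..skip_length s m}"
  shows "skipped s Y i = skipped s Y' i"
proof -
  have "i - 1 \<le> (m - 1) div s" using assms(3) by (auto simp: skip_length_def)
  then have "(i - 1) * s \<le> (m - 1) div s * s" by (rule mult_le_mono1)
  also have "\<dots> \<le> m - 1" by (rule div_times_less_eq_dividend)
  finally have "(i - 1) * s \<le> m - 1" .
  then have "1 + (i - 1) * s \<in> {1..m}" using assms(1) by simp
  then show ?thesis unfolding skipped_def by (rule assms(2))
qed

text \<open>The interval reads only the first \<open>m\<close> states, so it is a function of their
  list; this makes the event in the theorem measurable.\<close>

lemma T_hat_cong: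
  assumes "1 \<le> m" "\<And>t. t \<in> {1..m} \<Longrightarrow> Y t = Y' t"
  shows "T_hat c_lo c_hi S \<phi> lam \<delta> m Y = T_hat c_lo c_hi S \<phi> lam \<delta> m Y'"
proof -
  have W: "W_hat_skip S lam d s m Y = W_hat_skip S lam d s m Y'" for d s
    unfolding W_hat_skip_def by (rule W_hat_cong) (rule skipped_cong[OF assms])
  have k: "kappa_hat S lam s m Y = kappa_hat S lam s m Y'" for s
    unfolding kappa_hat_def
    by (rule arg_cong[where f = "kappa S"], rule P_hat_cong) (rule skipped_cong[OF assms])
  have s: "S_hat S \<phi> lam d m Y = S_hat S \<phi> lam d m Y'" for d
    by (simp only: S_hat_def W)
  show ?thesis by (simp only: T_hat_def kappa_star_hat_def K_hat_def W k s)
qed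

lemma mem_T_hat:
  assumes "finite S" "S \<noteq> {}" "ergodic S P" "universal_constants c_lo c_hi"
    and "\<bar>kappa_star_hat S \<phi> lam (\<delta>/2) m Y - kappa_star S P\<bar> < K_hat S \<phi> lam (\<delta>/2) m Y"
  shows "ereal (real (t_mix S P)) \<in> T_hat c_lo c_hi S \<phi> lam \<delta> m Y"
proof -
  define \<kappa> where "\<kappa> = kappa_star S P"
  define t where "t = real (t_mix S P)"
  define k where "k = kappa_star_hat S \<phi> lam (\<delta>/2) m Y"
  define K where "K = K_hat S \<phi> lam (\<delta>/2) m Y"
  define a where "a = 1 - max (k - K) 0"
  define b where "b = max (1 - k - K) 0"
  have \<kappa>: "0 \<le> \<kappa>" "\<kappa> < 1"
    using kappa_star_nonneg[OF assms(1,2)] kappa_star_less_1[OF assms(1-3)] by (auto simp: \<kappa>_def)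
  have c_lo: "1/2 \<le> c_lo" "c_lo < 1"
    using assms(4) universal_constants_lo_less_1 by (auto simp: universal_constants_def)
  have t: "c_lo / (1 - \<kappa>) \<le> t" "t \<le> c_hi / (1 - \<kappa>)"
    using universal_constantsD[OF assms(4,1-3)] by (simp_all add: \<kappa>_def t_def)
  have "0 < c_lo / (1 - \<kappa>)" using c_lo \<kappa> by simp
  \<comment> \<open>Positivity of \<open>t_mix\<close> is read off the lower universal bound,
    without exhibiting a time that satisfies the condition under \<open>LEAST\<close>; integrality
    then gives t \<ge> 1.\<close>
  then have t_pos: "0 < t" using t(1) by linarith
  then have c_hi: "0 < c_hi" using t(2) \<kappa> by (smt (verit) divide_nonpos_pos)
  have t1: "1 \<le> t" using t_pos by (simp add: t_def)
  have dev: "\<bar>k - \<kappa>\<bar> < K" using assms(5) by (simp add: k_def K_def \<kappa>_def)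
  have lo: "c_lo / a < t"
  proof (cases "\<kappa> = 0")
    \<comment> \<open>Here the truncation at 0 is active: a = 1 - \<kappa>, and the deviation bound
      leaves no gap between the two.\<close>
    case True
    then have "a = 1" using dev by (simp add: a_def)
    then show ?thesis using c_lo t1 by simp
  next
    case False
    then have "1 - \<kappa> < a" using dev \<kappa> by (auto simp: a_def)
    then have "c_lo / a < c_lo / (1 - \<kappa>)" using \<kappa> c_lo by (intro divide_strict_left_mono) auto
    then show ?thesis using t(1) by simp
  qed
  have hi: "t < c_hi / b" if "b \<noteq> 0"
  proof -
    have "0 < b" "b < 1 - \<kappa>" using that dev \<kappa> by (auto simp: b_def max_def split: if_splits)
    then have "c_hi / (1 - \<kappa>) < c_hi / b" using \<kappa> c_hi by (intro divide_strict_left_mono) auto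
    then show ?thesis using t(2) by simp
  qed
  show ?thesis
    using lo hi
    by (simp add: T_hat_def Let_def k_def[symmetric] K_def[symmetric] a_def[symmetric]
        b_def[symmetric] t_def[symmetric])
qed

theorem theorem4p1:
  fixes S :: "'a set"
    and P :: "'a \<Rightarrow> 'a \<Rightarrow> real"
    and \<mu> :: "'a pmf"
    and \<phi> :: "nat \<Rightarrow> nat"
    and lam :: "'a \<Rightarrow> real"
    and \<delta> c_lo c_hi :: real
    and m :: nat
    and M :: "'w measure"
    and X :: "nat \<Rightarrow> 'w \<Rightarrow> 'a"
  assumes "finite S" and "S \<noteq> {}"
    and "ergodic S P"
    and "\<mu> \<in> distributions S"
    and "0 < \<delta>" and "\<delta> < 1"
    and "\<forall>x\<in>S. 0 < lam x"
    and "1 \<le> m"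
    and "\<forall>n\<ge>1. 1 \<le> \<phi> n"
    and "mono_on {1..} \<phi>"
    and "filterlim \<phi> at_top at_top"
    and "universal_constants c_lo c_hi"
    and "prob_space M"
    and "markov_trajectory M S \<mu> P m X"
  shows "1 - \<delta> \<le> measure M {\<omega>\<in>space M.
           ereal (real (t_mix S P)) \<in> T_hat c_lo c_hi S \<phi> lam \<delta> m (\<lambda>t. X t \<omega>)}"
proof -
  interpret prob_space M by fact
  define r where "r = nat \<lceil>sqrt (real m)\<rceil>"
  have "0 < sqrt (real m)" using assms(8) by simp
  then have ceil: "0 < \<lceil>sqrt (real m)\<rceil>" by linarith
  then have r: "1 \<le> r" "of_int \<lceil>sqrt (real m)\<rceil> = real r"
    unfolding r_def by (linarith, simp del: zero_less_ceiling)
  have P: "row_stochastic S P" using assms(3) by (simp add: ergodic_def)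
  have lam: "0 < lam x" if "x \<in> S" for x using assms(7) that by blast
  \<comment> \<open>The share of a pair (\<sigma>, s): \<sigma> values of s and r values of \<sigma>
    add up to \<delta>/2. At \<sigma> = \<open>S_hat\<close> it is the confidence at which
    \<open>K_hat\<close> evaluates the widths.\<close>
  define d where "d = (\<lambda>\<sigma>::nat. \<delta> / 2 / (real r * real \<sigma>))"
  define ok where "ok = (\<lambda>\<sigma> s \<omega>. \<bar>kappa_hat S lam s m (\<lambda>t. X t \<omega>) - kappa S (mat_pow S P s)\<bar>
      \<le> W_hat_skip S lam (d \<sigma>) s m (\<lambda>t. X t \<omega>))"
  define I where "I = (SIGMA \<sigma>:{1..r}. {1..\<sigma>})"
  have "\<exists>B. B \<in> sets M \<and> measure M B \<le> d (fst i) \<and> (\<forall>\<omega>\<in>space M - B. ok (fst i) (snd i) \<omega>)"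
    if i: "i \<in> I" for i
  proof -
    have "1 * 1 \<le> real r * real (fst i)" using i r(1) by (intro mult_mono) (auto simp: I_def)
    then have d: "0 < d (fst i)" "d (fst i) \<le> 1"
      using assms(5,6) by (auto simp: d_def pos_divide_le_eq)
    have s: "1 \<le> snd i" using i by (auto simp: I_def)
    show ?thesis
      unfolding ok_def
      by (rule kappa_hat_confidence[OF assms(1,2) P assms(4) _ assms(8,13,14) s d, of lam])
         (use lam in \<open>auto intro!: exI\<close>)
  qed
  then obtain B where B: "\<And>i. i \<in> I \<Longrightarrow> B i \<in> sets M" "\<And>i. i \<in> I \<Longrightarrow> measure M (B i) \<le> d (fst i)"
    "\<And>i \<omega>. i \<in> I \<Longrightarrow> \<omega> \<in> space M - B i \<Longrightarrow> ok (fst i) (snd i) \<omega>"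
    using bchoice[of I "\<lambda>i B. B \<in> sets M \<and> measure M B \<le> d (fst i)
      \<and> (\<forall>\<omega>\<in>space M - B. ok (fst i) (snd i) \<omega>)"] by blast
  define U where "U = (\<Union>i\<in>I. B i)"
  have finI: "finite I" by (simp add: I_def)
  have U: "U \<in> sets M" unfolding U_def using B(1) finI by auto
  have "measure M U \<le> (\<Sum>i\<in>I. measure M (B i))"
    unfolding U_def using B(1) by (intro finite_measure_subadditive_finite finI) auto
  also have "\<dots> \<le> (\<Sum>i\<in>I. d (fst i))" by (intro sum_mono B(2))
  also have "\<dots> = (\<Sum>\<sigma>\<in>{1..r}. \<Sum>s\<in>{1..\<sigma>}. d \<sigma>)"
    unfolding I_def by (subst sum.Sigma) (auto simp: case_prod_unfold)
  also have "\<dots> = (\<Sum>\<sigma>\<in>{1..r}. \<delta> / 2 / real r)"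
    by (intro sum.cong) (auto simp: d_def)
  also have "\<dots> = \<delta> / 2" using r(1) by simp
  finally have "1 - \<delta> \<le> 1 - measure M U" using assms(5) by simp
  also have "\<dots> = measure M (space M - U)" by (rule prob_compl[OF U, symmetric])
  also have "\<dots> \<le> measure M {\<omega>\<in>space M.
           ereal (real (t_mix S P)) \<in> T_hat c_lo c_hi S \<phi> lam \<delta> m (\<lambda>t. X t \<omega>)}"
  proof (rule finite_measure_mono)
    define L where "L = (\<lambda>\<omega>. map (\<lambda>t. X t \<omega>) [1..<Suc m])"
    have "X t \<omega> = L \<omega> ! (t - 1)" if "t \<in> {1..m}" for t \<omega>
      using that by (cases t) (auto simp: L_def simp del: upt_Suc)
    then have "T_hat c_lo c_hi S \<phi> lam \<delta> m (\<lambda>t. X t \<omega>)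
        = T_hat c_lo c_hi S \<phi> lam \<delta> m (\<lambda>t. L \<omega> ! (t - 1))" for \<omega>
      by (rule T_hat_cong[OF assms(8)])
    then show "{\<omega>\<in>space M. ereal (real (t_mix S P)) \<in> T_hat c_lo c_hi S \<phi> lam \<delta> m (\<lambda>t. X t \<omega>)}
        \<in> sets M"
      unfolding L_def
      by (simp only:) (rule markov_trajectory_path_exp(1)[OF assms(1,13,14,8),
          where R = "\<lambda>l. ereal (real (t_mix S P)) \<in> T_hat c_lo c_hi S \<phi> lam \<delta> m (\<lambda>t. l ! (t - 1))"])
  next
    show "space M - U \<subseteq> {\<omega>\<in>space M.
        ereal (real (t_mix S P)) \<in> T_hat c_lo c_hi S \<phi> lam \<delta> m (\<lambda>t. X t \<omega>)}"
    proof safe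
      fix \<omega> assume \<omega>: "\<omega> \<in> space M" "\<omega> \<notin> U"
      \<comment> \<open>The cutoff depends on \<omega>, but outside \<open>U\<close> the bounds hold
        for all pairs in \<open>I\<close> simultaneously, so they may be read off at its random
        value.\<close>
      define \<sigma> where "\<sigma> = S_hat S \<phi> lam (\<delta>/2) m (\<lambda>t. X t \<omega>)"
      have "1 \<le> \<phi> m" "0 < \<delta> / 2" "\<delta> / 2 \<le> 1 / 2" using assms(5,6,8,9) by auto
      then have \<sigma>: "1 \<le> \<sigma>" "\<sigma> \<le> r"
        unfolding \<sigma>_def r_def by (intro S_hat_bounds assms(1,2,8) lam; simp)+
      have "\<bar>kappa_hat S lam s m (\<lambda>t. X t \<omega>) - kappa S (mat_pow S P s)\<bar>
          \<le> W_hat_skip S lam (d \<sigma>) s m (\<lambda>t. X t \<omega>)" if "s \<in> {1..\<sigma>}" for s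
        using B(3)[of "(\<sigma>, s)" \<omega>] that \<sigma> \<omega> by (auto simp: I_def U_def ok_def)
      from kappa_star_deviation[OF assms(1,2) P \<sigma>(1) this]
      show "ereal (real (t_mix S P)) \<in> T_hat c_lo c_hi S \<phi> lam \<delta> m (\<lambda>t. X t \<omega>)"
        by (intro mem_T_hat[OF assms(1-3,12)])
           (simp only: kappa_star_hat_def K_hat_def \<sigma>_def[symmetric] d_def r(2))
    qed
  qed
  finally show ?thesis .
qed

end
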